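(* For every fixed positive integer $c$, the problem $(c,k)$-Load Coloring, parameterized by $k$ (with $k\ge 1$), admits a kernel with less than $f(2c,k,2ck)=16c^{2}k-6ck$ edges, where $f(c,k,n)=(2c-1)ck+2n(c-1)$.
   Context: Graphs are finite, simple and undirected; $[c]=\{1,\dots,c\}$. $(c,k)$-Load Coloring: given a graph $G=(V,E)$, a positive integer $c$ and a nonnegative integer $k$, decide whether there is a map $\varphi:V\to[c]$ such that for every $i\in[c]$ at least $k$ edges have both endvertices colored $i$. Write $G\in(c,k)$-LCP if such a $\varphi$ exists. Here $c$ is fixed and $k$ is the parameter. Kernel: the problem (for fixed $c$) admits a kernel with less than $s(k)$ edges if there is a polynomial-time algorithm mapping each instance $(G,k)$ to an instance $(G',k')$ of the same problem such that $G\in(c,k)$-LCP if and only if $G'\in(c,k')$-LCP, $k'\le g(k)$ and the size of $G'$ is at most $g(k)$ for some function $g$ of $k$ only, and $|E(G')|<s(k)$. *)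

theory Defs
  imports Complex_Main "HOL-Computational_Algebra.Polynomial"
begin

section \<open>Load coloring\<close>

definition simple_graph :: "'a set \<Rightarrow> 'a set set \<Rightarrow> bool" where
  "simple_graph V E \<longleftrightarrow> finite V \<and> (\<forall>e\<in>E. e \<subseteq> V \<and> card e = 2)"

definition load_colorable :: "nat \<Rightarrow> nat \<Rightarrow> 'a set \<Rightarrow> 'a set set \<Rightarrow> bool" where
  "load_colorable c k V E \<longleftrightarrow>
     (\<exists>\<phi> :: 'a \<Rightarrow> nat. \<phi> ` V \<subseteq> {1..c} \<and>
        (\<forall>i\<in>{1..c}. k \<le> card {e \<in> E. \<forall>v\<in>e. \<phi> v = i}))"

section \<open>A model of computation\<close>

text \<open>
  Polynomial time is measured on a WHILE language over binary trees (as in N. D. Jones,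
  Computability and Complexity, 1997). The data operations are constant, pairing and the two
  projections. An assignment is charged the size of the value it stores, so values cannot grow
  faster than the elapsed time, and polynomial time in this model coincides with polynomial
  time on Turing machines.
\<close>

datatype tree = Leaf | Node tree tree

datatype expr = Var nat | Empty | Pair expr expr | First expr | Second expr

datatype com =
    Skip
  | Assign nat expr
  | Seq com com
  | Cond expr com com
  | While expr com

type_synonym store = "nat \<Rightarrow> tree"

fun left :: "tree \<Rightarrow> tree" where
  "left Leaf = Leaf"
| "left (Node a b) = a"

fun right :: "tree \<Rightarrow> tree" where
  "right Leaf = Leaf"
| "right (Node a b) = b"

fun eval_expr :: "expr \<Rightarrow> store \<Rightarrow> tree" where
  "eval_expr (Var x) s = s x"
| "eval_expr Empty s = Leaf"
| "eval_expr (Pair a b) s = Node (eval_expr a s) (eval_expr b s)"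
| "eval_expr (First a) s = left (eval_expr a s)"
| "eval_expr (Second a) s = right (eval_expr a s)"

text \<open>\<open>runs p s t s'\<close>: started in store \<open>s\<close>, program \<open>p\<close> halts after time \<open>t\<close> in store \<open>s'\<close>.
  The tree \<open>Leaf\<close> plays the role of false in tests.\<close>

inductive runs :: "com \<Rightarrow> store \<Rightarrow> nat \<Rightarrow> store \<Rightarrow> bool" where
  Skip: "runs Skip s 1 s"
| Assign: "runs (Assign x a) s (1 + size (eval_expr a s)) (s(x := eval_expr a s))"
| Seq: "runs p s t s' \<Longrightarrow> runs q s' u s'' \<Longrightarrow> runs (Seq p q) s (t + u) s''"
| CondTrue: "eval_expr b s \<noteq> Leaf \<Longrightarrow> runs p s t s' \<Longrightarrow> runs (Cond b p q) s (1 + t) s'"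
| CondFalse: "eval_expr b s = Leaf \<Longrightarrow> runs q s t s' \<Longrightarrow> runs (Cond b p q) s (1 + t) s'"
| WhileFalse: "eval_expr b s = Leaf \<Longrightarrow> runs (While b p) s 1 s"
| WhileTrue: "eval_expr b s \<noteq> Leaf \<Longrightarrow> runs p s t s' \<Longrightarrow> runs (While b p) s' u s'' \<Longrightarrow>
    runs (While b p) s (1 + t + u) s''"

text \<open>Input and output are held in variable 0; all other variables are initially \<open>Leaf\<close>.\<close>

definition polytime_computable ::
    "'a set \<Rightarrow> ('a \<Rightarrow> tree) \<Rightarrow> ('b \<Rightarrow> tree) \<Rightarrow> ('a \<Rightarrow> 'b) \<Rightarrow> bool" where
  "polytime_computable A enc enc' F \<longleftrightarrow>
     (\<exists>(p :: com) (P :: nat poly). \<forall>x\<in>A. \<exists>t s.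
        runs p ((\<lambda>_. Leaf)(0 := enc x)) t s \<and>
        t \<le> poly P (size (enc x)) \<and>
        s 0 = enc' (F x))"

section \<open>Instances, their encoding, and kernels\<close>

text \<open>The triple \<open>(n, E, k)\<close> is the instance with vertex set \<open>{..<n}\<close>, edge set \<open>E\<close> and
  parameter \<open>k\<close>.\<close>

type_synonym lc_instance = "nat \<times> nat set set \<times> nat"

definition lc_instances :: "lc_instance set" where
  "lc_instances = {(n, E, k). simple_graph {..<n} E \<and> 1 \<le> k}"

definition LCP :: "nat \<Rightarrow> lc_instance set" where
  "LCP c = {(n, E, k) \<in> lc_instances. load_colorable c k {..<n} E}"

fun enc_list :: "tree list \<Rightarrow> tree" where
  "enc_list [] = Leaf"
| "enc_list (x # xs) = Node x (enc_list xs)"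

definition enc_bool :: "bool \<Rightarrow> tree" where
  "enc_bool b = (if b then Node Leaf Leaf else Leaf)"

text \<open>An instance is encoded by the adjacency matrix of its graph together with the parameter in
  unary, the usual convention for parameterized problems: running times are polynomial in the
  size of the graph plus the parameter.\<close>

definition enc_instance :: "lc_instance \<Rightarrow> tree" where
  "enc_instance = (\<lambda>(n, E, k). Node
     (enc_list (map (\<lambda>i. enc_list (map (\<lambda>j. enc_bool ({i, j} \<in> E)) [0..<n])) [0..<n]))
     (enc_list (replicate k Leaf)))"

definition admits_kernel_edges :: "nat \<Rightarrow> (nat \<Rightarrow> int) \<Rightarrow> bool" where
  "admits_kernel_edges c b \<longleftrightarrow>
     (\<exists>(K :: lc_instance \<Rightarrow> lc_instance) (g :: nat \<Rightarrow> nat).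
        polytime_computable lc_instances enc_instance enc_instance K \<and>
        (\<forall>(n, E, k) \<in> lc_instances. \<forall>n' E' k'. K (n, E, k) = (n', E', k') \<longrightarrow>
           (n', E', k') \<in> lc_instances \<and>
           ((n, E, k) \<in> LCP c \<longleftrightarrow> (n', E', k') \<in> LCP c) \<and>
           k' \<le> g k \<and>
           n' + card E' \<le> g k \<and>
           int (card E') < b k))"

definition edge_bound :: "int \<Rightarrow> int \<Rightarrow> int \<Rightarrow> int" where
  "edge_bound c k n = (2 * c - 1) * c * k + 2 * n * (c - 1)"

section \<open>Sanity checks\<close>

lemma runs_deterministic:
  assumes "runs p s t s'" "runs p s u s''"
  shows "t = u \<and> s' = s''"
  using assms
proof (induction arbitrary: u s'' rule: runs.induct)
  case (Skip s)
  then show ?case by cases simp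
next
  case (Assign x a s)
  then show ?case by cases simp
next
  case (Seq p s t s1 q v s2)
  from Seq.prems obtain t1 t2 r where "runs p s t1 r" "runs q r t2 s''" "u = t1 + t2"
    by cases
  then show ?case using Seq.IH by blast
next
  case (CondTrue b s p t s1 q)
  from CondTrue.prems CondTrue.hyps obtain t1 where "runs p s t1 s''" "u = 1 + t1"
    by cases auto
  then show ?case using CondTrue.IH by blast
next
  case (CondFalse b s q t s1 p)
  from CondFalse.prems CondFalse.hyps obtain t1 where "runs q s t1 s''" "u = 1 + t1"
    by cases auto
  then show ?case using CondFalse.IH by blast
next
  case (WhileFalse b s p)
  from WhileFalse.prems WhileFalse.hyps show ?case by cases auto
next
  case (WhileTrue b s p t s1 v s2)
  from WhileTrue.prems WhileTrue.hyps obtain t1 t2 r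
    where "runs p s t1 r" "runs (While b p) r t2 s''" "u = 1 + t1 + t2"
    by cases auto
  then show ?case using WhileTrue.IH by blast
qed

lemma enc_list_inject [simp]: "enc_list xs = enc_list ys \<longleftrightarrow> xs = ys"
proof (induction xs arbitrary: ys)
  case Nil then show ?case by (cases ys) auto
next
  case (Cons x xs) then show ?case by (cases ys) auto
qed

lemma inj_on_enc_instance: "inj_on enc_instance lc_instances"
proof (rule inj_onI)
  fix x y assume x: "x \<in> lc_instances" and y: "y \<in> lc_instances"
    and eq: "enc_instance x = enc_instance y"
  obtain n E k where x': "x = (n, E, k)" by (cases x)
  obtain n' E' k' where y': "y = (n', E', k')" by (cases y)
  let ?M = "\<lambda>n E. map (\<lambda>i. enc_list (map (\<lambda>j. enc_bool ({i, j} \<in> E)) [0..<n])) [0..<n]"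
  have M: "?M n E = ?M n' E'" and k: "replicate k Leaf = replicate k' Leaf"
    using eq unfolding x' y' enc_instance_def by (auto simp del: map_eq_conv)
  have n: "n = n'" using arg_cong[OF M, of length] by simp
  have adj: "{i, j} \<in> E \<longleftrightarrow> {i, j} \<in> E'" if "i < n" "j < n" for i j
  proof -
    have "\<forall>i\<in>{0..<n'}. \<forall>j\<in>{0..<n'}. enc_bool ({i, j} \<in> E) = enc_bool ({i, j} \<in> E')"
      using M unfolding n by simp
    then have "enc_bool ({i, j} \<in> E) = enc_bool ({i, j} \<in> E')"
      using that unfolding n by simp
    then show ?thesis
      by (simp add: enc_bool_def split: if_splits)
  qed
  have "e \<in> E \<longleftrightarrow> e \<in> E'" for e
  proof (cases "\<exists>i j. e = {i, j} \<and> i < n \<and> j < n")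
    case True then show ?thesis using adj by blast
  next
    case False
    then have "\<not> (e \<subseteq> {..<n} \<and> card e = 2)" by (auto simp: card_2_iff)
    then show ?thesis
      using x y unfolding x' y' n lc_instances_def simple_graph_def by auto
  qed
  moreover have "k = k'" using arg_cong[OF k, of length] by simp
  ultimately show "x = y" unfolding x' y' n by blast
qed

end

theory Submission imports Defs begin

text \<open>
  The kernel scans the edges once and keeps an edge unless one of its ends already has
  \<open>D = (2c - 1)k\<close> kept edges or \<open>M = c(10c - 9)k\<close> edges have been kept; isolated vertices are
  then dropped and the parameter is unchanged.

  Deleting an edge at a vertex \<open>v\<close> that retains degree \<open>D\<close> is safe: the other \<open>c - 1\<close> colours need
  at most \<open>2(c - 1)k\<close> vertices, so recolouring everything else with the colour of \<open>v\<close> leaves \<open>k\<close>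
  edges at \<open>v\<close>. If \<open>M\<close> edges are kept, the kept graph is a yes-instance, because it has maximum
  degree at most \<open>D\<close>: one can repeatedly split off a vertex set that induces \<open>k\<close> edges but has degree
  sum at most \<open>10ck\<close>. Such a set is found by deleting vertices one at a time from the whole graph so
  that the number of induced edges never falls behind its value in a random graph with the same
  degrees; an averaging argument supplies the next vertex to delete.
\<close>

section \<open>Load colorings of graphs of bounded degree\<close>

lemma simple_graph_finite: "simple_graph V E \<Longrightarrow> finite E"
  unfolding simple_graph_def by (meson PowI finite_Pow_iff finite_subset subsetI)

lemma load_colorable_mono:
  assumes "load_colorable c k V E'" "E' \<subseteq> E" "finite E"
  shows "load_colorable c k V E"
proof -
  obtain \<phi> :: "'a \<Rightarrow> nat" where \<phi>: "\<phi> ` V \<subseteq> {1..c}"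
    "\<forall>i\<in>{1..c}. k \<le> card {e \<in> E'. \<forall>v\<in>e. \<phi> v = i}"
    using assms(1) unfolding load_colorable_def by blast
  have "card {e \<in> E'. \<forall>v\<in>e. \<phi> v = i} \<le> card {e \<in> E. \<forall>v\<in>e. \<phi> v = i}" for i
    using assms(2,3) by (intro card_mono) auto
  with \<phi> show ?thesis
    unfolding load_colorable_def by (meson le_trans)
qed

lemma load_colorable_remove_edge:
  assumes G: "simple_graph V E" and e: "e \<in> E" "v \<in> e" and c: "1 \<le> c"
    and deg: "(2 * c - 1) * k \<le> card {e' \<in> E - {e}. v \<in> e'}"
    and col: "load_colorable c k V E"
  shows "load_colorable c k V (E - {e})"
proof -
  obtain \<phi> where \<phi>: "\<phi> ` V \<subseteq> {1..c}"
    "\<forall>i\<in>{1..c}. k \<le> card {e \<in> E. \<forall>v\<in>e. \<phi> v = i}"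
    using col unfolding load_colorable_def by blast
  define i where "i = \<phi> v"
  have vV: "v \<in> V" using G e unfolding simple_graph_def by blast
  then have i: "i \<in> {1..c}" using \<phi>(1) i_def by blast
  have finE: "finite E" using simple_graph_finite[OF G] .
  have "\<forall>j\<in>{1..c}. \<exists>F. F \<subseteq> {e \<in> E. \<forall>v\<in>e. \<phi> v = j} \<and> card F = k"
  proof
    fix j assume "j \<in> {1..c}"
    with \<phi>(2) have "k \<le> card {e \<in> E. \<forall>v\<in>e. \<phi> v = j}" by blast
    from obtain_subset_with_card_n[OF this]
    show "\<exists>F. F \<subseteq> {e \<in> E. \<forall>v\<in>e. \<phi> v = j} \<and> card F = k" by blast
  qed
  from bchoice[OF this] obtain F
    where "\<forall>j\<in>{1..c}. F j \<subseteq> {e \<in> E. \<forall>v\<in>e. \<phi> v = j} \<and> card (F j) = k" ..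
  then have F: "F j \<subseteq> {e \<in> E. \<forall>v\<in>e. \<phi> v = j}" "card (F j) = k" if "j \<in> {1..c}" for j
    using that by simp_all
  \<comment> \<open>\<open>U\<close> holds the ends of \<open>k\<close> chosen edges for each colour
    other than \<open>i\<close>. Only these vertices keep their colour; all others will receive
    \<open>i\<close>.\<close>
  define U where "U = (\<Union>j\<in>{1..c} - {i}. \<Union>(F j))"
  have finF: "finite (F j)" if "j \<in> {1..c}" for j
    by (rule finite_subset[OF F(1)[OF that]]) (simp add: finE)
  have two: "card e' = 2" if "e' \<in> E" for e' using G that unfolding simple_graph_def by blast
  have cF: "card (\<Union>(F j)) \<le> 2 * k" if "j \<in> {1..c}" for j
  proof -
    have "card (\<Union>(F j)) \<le> (\<Sum>e\<in>F j. card e)" by (rule card_Union_le_sum_card)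
    also have "\<dots> = (\<Sum>e\<in>F j. 2)" using F(1)[OF that] two by (intro sum.cong) auto
    finally show ?thesis using F(2)[OF that] by simp
  qed
  have "card U \<le> (\<Sum>j\<in>{1..c} - {i}. card (\<Union>(F j)))"
    unfolding U_def by (intro card_UN_le) auto
  also have "\<dots> \<le> (\<Sum>j\<in>{1..c} - {i}. 2 * k)" using cF by (intro sum_mono) auto
  also have "\<dots> = (c - 1) * (2 * k)" using i by simp
  finally have cU: "card U \<le> (c - 1) * (2 * k)" .
  have "U \<subseteq> V" using F(1) G unfolding U_def simple_graph_def by blast
  then have finU: "finite U" using G unfolding simple_graph_def by (meson finite_subset)
  have U_col: "\<exists>j\<in>{1..c} - {i}. \<phi> w = j" if "w \<in> U" for w
    using that F(1) unfolding U_def by blast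
  have vU: "v \<notin> U" using U_col i_def by auto
  define \<psi> where "\<psi> w = (if w \<in> U then \<phi> w else i)" for w
  have "\<psi> ` V \<subseteq> {1..c}" using i \<phi>(1) by (auto simp: \<psi>_def)
  moreover have "k \<le> card {e' \<in> E - {e}. \<forall>w\<in>e'. \<psi> w = j}" if j: "j \<in> {1..c}" for j
  proof (cases "j = i")
    case False
    then have sub: "\<Union>(F j) \<subseteq> U" using j unfolding U_def by blast
    \<comment> \<open>The deleted edge contains \<open>v\<close>, which lies outside
      \<open>U\<close>, so it is not among the chosen edges.\<close>
    have "F j \<subseteq> {e' \<in> E - {e}. \<forall>w\<in>e'. \<psi> w = j}"
    proof
      fix e' assume e': "e' \<in> F j"
      then have "e' \<subseteq> U" using sub by blast
      then show "e' \<in> {e' \<in> E - {e}. \<forall>w\<in>e'. \<psi> w = j}"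
        using F(1)[OF j] e' vU e(2) by (auto simp: \<psi>_def)
    qed
    then show ?thesis using F(2)[OF j] card_mono[of "{e' \<in> E - {e}. \<forall>w\<in>e'. \<psi> w = j}" "F j"] finE by simp
  next
    case True
    let ?N = "{e' \<in> E - {e}. v \<in> e'}"
    \<comment> \<open>An edge at \<open>v\<close> that meets \<open>U\<close> is determined by its
      other end, so at most \<open>card U\<close> of the edges at \<open>v\<close> fail to become
      monochromatic.\<close>
    have "{e' \<in> ?N. e' \<inter> U \<noteq> {}} \<subseteq> (\<lambda>u. {v, u}) ` U"
    proof
      fix e' assume "e' \<in> {e' \<in> ?N. e' \<inter> U \<noteq> {}}"
      then obtain u where u: "u \<in> e'" "u \<in> U" and e': "e' \<in> E" "v \<in> e'" by blast
      have "e' = {v, u}" using two[OF e'(1)] u e'(2) vU by (auto simp: card_2_iff)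
      then show "e' \<in> (\<lambda>u. {v, u}) ` U" using u by blast
    qed
    then have "card {e' \<in> ?N. e' \<inter> U \<noteq> {}} \<le> card U"
      using finU surj_card_le by blast
    moreover have split: "?N = {e' \<in> ?N. e' \<inter> U \<noteq> {}} \<union> {e' \<in> ?N. e' \<inter> U = {}}" by blast
    have "card ?N \<le> card {e' \<in> ?N. e' \<inter> U \<noteq> {}} + card {e' \<in> ?N. e' \<inter> U = {}}"
      by (rule ord_eq_le_trans[OF arg_cong[OF split, of card] card_Un_le])
    ultimately have "card ?N \<le> (c - 1) * (2 * k) + card {e' \<in> ?N. e' \<inter> U = {}}"
      using cU by linarith
    moreover have "(2 * c - 1) * k = (c - 1) * (2 * k) + k"
      using c by (cases c) (auto simp: algebra_simps)
    ultimately have "k \<le> card {e' \<in> ?N. e' \<inter> U = {}}" using deg by linarith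
    also have "\<dots> \<le> card {e' \<in> E - {e}. \<forall>w\<in>e'. \<psi> w = j}"
      using finE True by (intro card_mono) (auto simp: \<psi>_def)
    finally show ?thesis .
  qed
  ultimately show ?thesis unfolding load_colorable_def by blast
qed

section \<open>Vertex sets of small degree sum that induce \<open>k\<close> edges\<close>

lemma sum_sum_remove:
  fixes w :: "'a \<Rightarrow> 'a \<Rightarrow> int"
  assumes "finite U" "z \<in> U" "w z z = 0" and sym: "\<And>x y. w x y = w y x"
  shows "(\<Sum>x\<in>U - {z}. \<Sum>y\<in>U - {z}. w x y) = (\<Sum>x\<in>U. \<Sum>y\<in>U. w x y) - 2 * (\<Sum>y\<in>U. w z y)"
proof -
  have "(\<Sum>x\<in>U. \<Sum>y\<in>U. w x y) = (\<Sum>y\<in>U. w z y) + (\<Sum>x\<in>U - {z}. \<Sum>y\<in>U. w x y)"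
    using assms(1,2) by (rule sum.remove)
  also have "(\<Sum>x\<in>U - {z}. \<Sum>y\<in>U. w x y) = (\<Sum>x\<in>U - {z}. w x z + (\<Sum>y\<in>U - {z}. w x y))"
    using assms(1,2) by (intro sum.cong refl) (rule sum.remove)
  also have "\<dots> = (\<Sum>x\<in>U - {z}. w z x) + (\<Sum>x\<in>U - {z}. \<Sum>y\<in>U - {z}. w x y)"
    by (simp add: sum.distrib sym[of _ z])
  also have "(\<Sum>x\<in>U - {z}. w z x) = (\<Sum>y\<in>U. w z y)"
    using assms(3) by (simp add: sum.remove[OF assms(1,2)])
  finally show ?thesis by simp
qed

text \<open>Averaging: an ordered pair of distinct vertices survives the removal of \<open>z\<close>
  for all but two choices of \<open>z\<close>. Hence the sums left after removing \<open>z\<close>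
  add up, over all \<open>z\<close> in \<open>U\<close>, to \<open>card U - 2\<close> times the full
  double sum, and they cannot all be negative.\<close>

lemma exists_remove_nonneg:
  fixes w :: "'a \<Rightarrow> 'a \<Rightarrow> int"
  assumes fin: "finite U" and card: "2 \<le> card U" and diag: "\<And>x. w x x = 0"
    and sym: "\<And>x y. w x y = w y x" and nonneg: "0 \<le> (\<Sum>x\<in>U. \<Sum>y\<in>U. w x y)"
  shows "\<exists>z\<in>U. 0 \<le> (\<Sum>x\<in>U - {z}. \<Sum>y\<in>U - {z}. w x y)"
proof (rule ccontr)
  let ?S = "\<Sum>x\<in>U. \<Sum>y\<in>U. w x y"
  assume "\<not> ?thesis"
  then have neg: "(\<Sum>x\<in>U - {z}. \<Sum>y\<in>U - {z}. w x y) < 0" if "z \<in> U" for z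
    using that by force
  have "U \<noteq> {}" using card by auto
  then have "(\<Sum>z\<in>U. \<Sum>x\<in>U - {z}. \<Sum>y\<in>U - {z}. w x y) < (\<Sum>z\<in>U. 0)"
    using fin neg by (intro sum_strict_mono) auto
  also have "(\<Sum>z\<in>U. \<Sum>x\<in>U - {z}. \<Sum>y\<in>U - {z}. w x y) = (\<Sum>z\<in>U. ?S - 2 * (\<Sum>y\<in>U. w z y))"
    using sum_sum_remove[OF fin _ diag sym] by (intro sum.cong) auto
  also have "\<dots> = (int (card U) - 2) * ?S"
    by (simp add: sum_subtractf sum_distrib_left[symmetric] algebra_simps)
  finally have "(int (card U) - 2) * ?S < 0" by simp
  moreover have "0 \<le> (int (card U) - 2) * ?S" using card nonneg by (intro mult_nonneg_nonneg) auto
  ultimately show False by linarith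
qed

text \<open>For fixed \<open>x\<close> the neighbours in \<open>U\<close> correspond to the induced
  edges at \<open>x\<close>; summing over \<open>x\<close> then meets each induced edge at both of
  its ends.\<close>

lemma sum_adj_pairs:
  assumes G: "simple_graph V E" and U: "U \<subseteq> V"
  shows "(\<Sum>x\<in>U. \<Sum>y\<in>U. if {x, y} \<in> E then 1 else 0) = (2 * card {e \<in> E. e \<subseteq> U} :: nat)"
proof -
  have fin: "finite U" using G U unfolding simple_graph_def by (meson finite_subset)
  have finE: "finite E" using simple_graph_finite[OF G] .
  have two: "card e = 2" if "e \<in> E" for e using G that unfolding simple_graph_def by blast
  have "(\<Sum>x\<in>U. \<Sum>y\<in>U. if {x, y} \<in> E then 1 else 0) = (\<Sum>x\<in>U. card {e \<in> {e \<in> E. e \<subseteq> U}. x \<in> e})"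
  proof (rule sum.cong)
    fix x assume x: "x \<in> U"
    have "(\<Sum>y\<in>U. if {x, y} \<in> E then 1 else 0 :: nat) = card {y \<in> U. {x, y} \<in> E}"
      using fin by (simp add: sum.If_cases Int_def)
    also have "\<dots> = card ((\<lambda>y. {x, y}) ` {y \<in> U. {x, y} \<in> E})"
      by (intro card_image[symmetric]) (auto simp: inj_on_def doubleton_eq_iff)
    also have "(\<lambda>y. {x, y}) ` {y \<in> U. {x, y} \<in> E} = {e \<in> {e \<in> E. e \<subseteq> U}. x \<in> e}"
    proof (intro equalityI subsetI)
      fix e assume e: "e \<in> {e \<in> {e \<in> E. e \<subseteq> U}. x \<in> e}"
      then obtain y where "e = {x, y}" using two[of e] by (auto simp: card_2_iff)
      with e show "e \<in> (\<lambda>y. {x, y}) ` {y \<in> U. {x, y} \<in> E}" by auto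
    qed (use x in auto)
    finally show "(\<Sum>y\<in>U. if {x, y} \<in> E then 1 else 0) = card {e \<in> {e \<in> E. e \<subseteq> U}. x \<in> e}" .
  qed simp
  also have "\<dots> = 2 * card {e \<in> E. e \<subseteq> U}"
  proof (rule sum_multicount)
    show "\<forall>e\<in>{e \<in> E. e \<subseteq> U}. card {x \<in> U. x \<in> e} = 2"
    proof
      fix e assume e: "e \<in> {e \<in> E. e \<subseteq> U}"
      then have "{x \<in> U. x \<in> e} = e" by blast
      then show "card {x \<in> U. x \<in> e} = 2" using e two by simp
    qed
  qed (use fin finE in auto)
  finally show ?thesis .
qed

lemma sum_adj_degree:
  assumes G: "simple_graph V E" and x: "x \<in> V"
  shows "(\<Sum>y\<in>V. if {x, y} \<in> E then 1 else 0) = card {e \<in> E. x \<in> e}"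
proof -
  have fin: "finite V" using G unfolding simple_graph_def by blast
  have two: "e \<subseteq> V \<and> card e = 2" if "e \<in> E" for e using G that unfolding simple_graph_def by blast
  have "(\<Sum>y\<in>V. if {x, y} \<in> E then 1 else 0 :: nat) = card {y \<in> V. {x, y} \<in> E}"
    using fin by (simp add: sum.If_cases Int_def)
  also have "\<dots> = card ((\<lambda>y. {x, y}) ` {y \<in> V. {x, y} \<in> E})"
    by (intro card_image[symmetric]) (auto simp: inj_on_def doubleton_eq_iff)
  also have "(\<lambda>y. {x, y}) ` {y \<in> V. {x, y} \<in> E} = {e \<in> E. x \<in> e}"
  proof (intro equalityI subsetI)
    fix e assume e: "e \<in> {e \<in> E. x \<in> e}"
    then obtain y where "e = {x, y}" using two[of e] by (auto simp: card_2_iff)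
    with e two[of e] show "e \<in> (\<lambda>y. {x, y}) ` {y \<in> V. {x, y} \<in> E}" by auto
  qed auto
  finally show ?thesis .
qed

text \<open>The deletion process in extremal form: a smallest \<open>U\<close> with
  \<open>S U \<ge> 0\<close> and at least \<open>k\<close> induced edges can lose some vertex
  \<open>z\<close> while \<open>S\<close> stays nonnegative, and the rest then induces fewer than
  \<open>k\<close> edges. Nonnegativity of \<open>S\<close> bounds the volume (degree sum) of the
  rest, and \<open>z\<close> adds at most \<open>\<Delta>\<close> to it.\<close>

lemma exists_small_volume:
  assumes G: "simple_graph V E" and k: "1 \<le> k" "k \<le> card E"
    and \<Delta>: "\<And>v. v \<in> V \<Longrightarrow> card {e \<in> E. v \<in> e} \<le> \<Delta>"
    and B: "\<Delta> + \<Delta> \<le> B" "4 * card E * k \<le> (B - \<Delta>) * (B - 2 * \<Delta>)"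
  shows "\<exists>U\<subseteq>V. k \<le> card {e \<in> E. e \<subseteq> U} \<and> (\<Sum>v\<in>U. card {e \<in> E. v \<in> e}) \<le> B"
proof -
  define deg where "deg v = int (card {e \<in> E. v \<in> e})" for v
  define m where "m = int (card E)"
  define adj where "adj x y = (if {x, y} \<in> E then 1 else 0 :: int)" for x y
  \<comment> \<open>\<open>S U\<close> compares \<open>e(U)\<close> with \<open>(\<Sum>x\<noteq>y\<in>U. deg x deg y) / 4m\<close>, its expected value in the configuration model.\<close>
  define w where "w x y = (if x = y then 0 else 2 * m * adj x y - deg x * deg y)" for x y
  define S where "S U = (\<Sum>x\<in>U. \<Sum>y\<in>U. w x y)" for U
  have finV: "finite V" and two: "\<And>e. e \<in> E \<Longrightarrow> e \<subseteq> V \<and> card e = 2"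
    using G unfolding simple_graph_def by auto
  have adj0: "adj x x = 0" for x using two[of "{x}"] by (auto simp: adj_def)
  have w_alt: "w x y = 2 * m * adj x y - deg x * deg y + (if x = y then deg x * deg x else 0)" for x y
    by (simp add: w_def adj0)
  have adj_sum: "(\<Sum>x\<in>U. \<Sum>y\<in>U. adj x y) = 2 * int (card {e \<in> E. e \<subseteq> U})" if "U \<subseteq> V" for U
  proof -
    have "(\<Sum>x\<in>U. \<Sum>y\<in>U. adj x y) = int (\<Sum>x\<in>U. \<Sum>y\<in>U. if {x, y} \<in> E then 1 else 0)"
      by (auto simp: adj_def intro!: sum.cong)
    then show ?thesis using sum_adj_pairs[OF G that] by simp
  qed
  have S: "S U = 4 * m * int (card {e \<in> E. e \<subseteq> U}) - (\<Sum>x\<in>U. deg x)\<^sup>2 + (\<Sum>x\<in>U. (deg x)\<^sup>2)"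
    if "U \<subseteq> V" for U
  proof -
    have fin: "finite U" using finV that finite_subset by blast
    have "S U = 2 * m * (\<Sum>x\<in>U. \<Sum>y\<in>U. adj x y) - (\<Sum>x\<in>U. \<Sum>y\<in>U. deg x * deg y)
       + (\<Sum>x\<in>U. \<Sum>y\<in>U. if x = y then deg x * deg x else 0)"
      unfolding S_def w_alt by (simp add: sum.distrib sum_subtractf sum_distrib_left)
    also have "(\<Sum>x\<in>U. \<Sum>y\<in>U. deg x * deg y) = (\<Sum>x\<in>U. deg x)\<^sup>2"
      by (simp add: power2_eq_square sum_product)
    also have "(\<Sum>x\<in>U. \<Sum>y\<in>U. if x = y then deg x * deg x else 0) = (\<Sum>x\<in>U. (deg x)\<^sup>2)"
      using fin by (intro sum.cong) (auto simp: power2_eq_square)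
    finally show ?thesis using adj_sum[OF that] by simp
  qed
  have all: "{e \<in> E. e \<subseteq> V} = E" using two by blast
  have "(\<Sum>x\<in>V. deg x) = int (\<Sum>x\<in>V. \<Sum>y\<in>V. if {x, y} \<in> E then 1 else 0)"
    using sum_adj_degree[OF G] by (simp add: deg_def)
  also have "\<dots> = 2 * m" using sum_adj_pairs[OF G order_refl] all by (simp add: m_def)
  finally have volV: "(\<Sum>x\<in>V. deg x) = 2 * m" .
  \<comment> \<open>The volume of \<open>V\<close> is \<open>2m\<close>, so the first two terms of
    \<open>S V\<close> cancel and the sum of the squared degrees remains.\<close>
  have SV: "0 \<le> S V"
    unfolding S[OF order_refl] volV all by (simp add: m_def[symmetric] power2_eq_square sum_nonneg)
  let ?good = "\<lambda>U. U \<subseteq> V \<and> 0 \<le> S U \<and> k \<le> card {e \<in> E. e \<subseteq> U}"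
  have "?good V" using SV all k by simp
  then obtain U where U: "?good U" and minU: "\<And>U'. ?good U' \<Longrightarrow> card U \<le> card U'"
    using ex_has_least_nat[of ?good V card] by blast
  have finU: "finite U" using U finV finite_subset by blast
  have cU: "2 \<le> card U"
  proof -
    have "{e \<in> E. e \<subseteq> U} \<noteq> {}" using U k(1) by (metis card.empty not_one_le_zero order_trans)
    then obtain e where "e \<in> E" "e \<subseteq> U" by blast
    then show ?thesis using two[of e] card_mono[OF finU, of e] by simp
  qed
  have "\<exists>z\<in>U. 0 \<le> (\<Sum>x\<in>U - {z}. \<Sum>y\<in>U - {z}. w x y)"
    using finU cU U unfolding S_def
    by (intro exists_remove_nonneg) (auto simp: w_def adj_def insert_commute mult.commute)
  then obtain z where z: "z \<in> U" "0 \<le> S (U - {z})" unfolding S_def by blast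
  define U' where "U' = U - {z}"
  have U'V: "U' \<subseteq> V" using U U'_def by blast
  have "card U' < card U" unfolding U'_def using z(1) finU by (meson card_Diff1_less)
  \<comment> \<open>\<open>U'\<close> is smaller than \<open>U\<close> and has
    \<open>S U' \<ge> 0\<close>, so by minimality of \<open>U\<close> it can only fail the edge
    condition.\<close>
  then have few: "card {e \<in> E. e \<subseteq> U'} \<le> k"
    using minU[of U'] z(2) U'V unfolding U'_def by force
  have deg\<Delta>: "0 \<le> deg v \<and> deg v \<le> \<Delta>" if "v \<in> V" for v using \<Delta>[OF that] by (simp add: deg_def)
  define vol where "vol = (\<Sum>x\<in>U'. deg x)"
  \<comment> \<open>The degree bound makes the diagonal term linear in the volume, so
    \<open>S U' \<ge> 0\<close> turns into a quadratic inequality for \<open>vol\<close>.\<close>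
  have "(\<Sum>x\<in>U'. (deg x)\<^sup>2) \<le> (\<Sum>x\<in>U'. \<Delta> * deg x)"
    using deg\<Delta> U'V by (intro sum_mono) (auto simp: power2_eq_square intro!: mult_right_mono)
  also have "\<dots> = \<Delta> * vol" by (simp add: vol_def sum_distrib_left)
  finally have "vol\<^sup>2 \<le> 4 * m * int (card {e \<in> E. e \<subseteq> U'}) + \<Delta> * vol"
    using z(2) unfolding U'_def[symmetric] S[OF U'V] vol_def[symmetric] by linarith
  also have "\<dots> \<le> 4 * m * int k + \<Delta> * vol"
    using few by (simp add: m_def mult_left_mono)
  finally have vol: "vol * (vol - \<Delta>) \<le> 4 * m * int k" by (simp add: power2_eq_square algebra_simps)
  have volU: "(\<Sum>x\<in>U. deg x) = deg z + vol"
    unfolding vol_def U'_def using z finU by (simp add: sum.remove)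
  \<comment> \<open>If the volume of \<open>U\<close> exceeded \<open>B\<close>, that of
    \<open>U'\<close> would exceed \<open>B - \<Delta>\<close>, and
    \<open>vol * (vol - \<Delta>)\<close> would exceed
    \<open>(B - \<Delta>) * (B - 2 * \<Delta>)\<close>, hence \<open>4mk\<close>. Since
    \<open>2 * \<Delta> \<le> B\<close>, the natural subtractions are exact.\<close>
  have "(\<Sum>x\<in>U. deg x) \<le> int B"
  proof (rule ccontr)
    assume "\<not> ?thesis"
    then have big: "vol > int B - \<Delta>" using volU deg\<Delta>[of z] z U by auto
    have "4 * m * int k \<le> int ((B - \<Delta>) * (B - 2 * \<Delta>))"
      using B(2) unfolding m_def by (metis (mono_tags, lifting) of_nat_le_iff of_nat_mult of_nat_numeral)
    also have "\<dots> = (int B - \<Delta>) * (int B - 2 * \<Delta>)"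
      using B(1) by (simp add: of_nat_diff)
    also have "\<dots> < vol * (vol - \<Delta>)"
      using big B(1) by (intro mult_strict_mono') auto
    finally show False using vol by linarith
  qed
  then have "(\<Sum>v\<in>U. card {e \<in> E. v \<in> e}) \<le> B"
    unfolding deg_def by (metis (no_types) of_nat_le_iff of_nat_sum)
  then show ?thesis using U by blast
qed

section \<open>Graphs of bounded degree with many edges are yes-instances\<close>

text \<open>\<open>C\<close> is the final number of colours and stays fixed during the induction on
  \<open>c\<close>, so that the degree bound and the price \<open>10Ck\<close> of one colour class
  do not change. One class is split off as a set \<open>U\<close> of volume at most
  \<open>10Ck\<close>; the edges avoiding \<open>U\<close> still suffice for the other
  colours.\<close>

lemma load_colorable_dense:
  assumes C: "c \<le> C" and c: "1 \<le> c" and k: "1 \<le> k" and G: "simple_graph V E"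
    and \<Delta>: "\<And>v. v \<in> V \<Longrightarrow> card {e \<in> E. v \<in> e} \<le> (2 * C - 1) * k"
    and m: "(c - 1) * (10 * C * k) + k \<le> card E"
  shows "load_colorable c k V E"
  using c C G \<Delta> m
proof (induction c arbitrary: V E rule: dec_induct)
  case base
  have "{e \<in> E. \<forall>v\<in>e. (1 :: nat) = 1} = E" by simp
  then show ?case using base unfolding load_colorable_def by (intro exI[of _ "\<lambda>_. 1"]) auto
next
  case (step c V E0)
  have finE0: "finite E0" using simple_graph_finite[OF step.prems(2)] .
  \<comment> \<open>\<open>exists_small_volume\<close> needs \<open>4 * card E * k\<close> to be
    bounded above, so surplus edges are discarded first.\<close>
  obtain E where E: "E \<subseteq> E0" and cE: "card E = c * (10 * C * k) + k"
    using step.prems(4) obtain_subset_with_card_n[of "c * (10 * C * k) + k" E0] by auto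
  have G: "simple_graph V E" using step.prems(2) E unfolding simple_graph_def by blast
  have finE: "finite E" using finE0 E finite_subset by blast
  have \<Delta>: "card {e \<in> E. v \<in> e} \<le> (2 * C - 1) * k" if "v \<in> V" for v
  proof -
    have "card {e \<in> E. v \<in> e} \<le> card {e \<in> E0. v \<in> e}" using E finE0 by (intro card_mono) auto
    then show ?thesis using step.prems(3)[OF that] by linarith
  qed
  let ?B = "10 * C * k"
  have C1: "1 \<le> C" "c + 1 \<le> C" using step by auto
  have Dle: "(2 * C - 1) * k \<le> 2 * C * k" by simp
  \<comment> \<open>With \<open>B = 10Ck\<close> and \<open>\<Delta> \<le> 2Ck\<close> the factors
    \<open>B - \<Delta>\<close> and \<open>B - 2\<Delta>\<close> are at least \<open>8Ck\<close> and
    \<open>6Ck\<close>. The trimmed graph has at most \<open>10C^2k\<close> edges, so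
    \<open>40C^2k^2\<close> is compared with \<open>48C^2k^2\<close>.\<close>
  have "4 * card E * k \<le> (8 * C * k) * (6 * C * k)"
  proof -
    have "card E \<le> (c + 1) * (10 * C * k)" unfolding cE using C1 by simp
    also have "\<dots> \<le> C * (10 * C * k)" using C1 by (intro mult_right_mono) auto
    finally have "4 * card E * k \<le> 4 * (C * (10 * C * k)) * k" by simp
    also have "\<dots> \<le> (8 * C * k) * (6 * C * k)" by (simp add: algebra_simps)
    finally show ?thesis .
  qed
  also have "\<dots> \<le> (?B - (2 * C - 1) * k) * (?B - 2 * ((2 * C - 1) * k))"
    using Dle by (intro mult_mono; linarith)
  finally have "\<exists>U\<subseteq>V. k \<le> card {e \<in> E. e \<subseteq> U} \<and> (\<Sum>v\<in>U. card {e \<in> E. v \<in> e}) \<le> ?B"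
    using Dle cE by (intro exists_small_volume[OF G k _ \<Delta>]; linarith)
  then obtain U where U: "U \<subseteq> V" "k \<le> card {e \<in> E. e \<subseteq> U}" "(\<Sum>v\<in>U. card {e \<in> E. v \<in> e}) \<le> ?B"
    by blast
  have finU: "finite U" using U(1) G unfolding simple_graph_def by (meson finite_subset)
  define E' where "E' = {e \<in> E. e \<inter> U = {}}"
  \<comment> \<open>An edge meeting \<open>U\<close> is counted in the degree of a vertex of
    \<open>U\<close>, so passing to \<open>E'\<close> loses at most the volume of
    \<open>U\<close>.\<close>
  have "E = E' \<union> (\<Union>v\<in>U. {e \<in> E. v \<in> e})" unfolding E'_def by blast
  then have "card E \<le> card E' + card (\<Union>v\<in>U. {e \<in> E. v \<in> e})" by (metis card_Un_le)
  also have "\<dots> \<le> card E' + ?B" using card_UN_le[OF finU, of "\<lambda>v. {e \<in> E. v \<in> e}"] U(3) by linarith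
  finally have cE': "(c - 1) * ?B + k \<le> card E'" using cE step(1) by (cases c) auto
  have "load_colorable c k (V - U) E'"
  proof (rule step.IH)
    show "simple_graph (V - U) E'" using G unfolding simple_graph_def E'_def by auto
    show "card {e \<in> E'. v \<in> e} \<le> (2 * C - 1) * k" if "v \<in> V - U" for v
    proof -
      have "card {e \<in> E'. v \<in> e} \<le> card {e \<in> E. v \<in> e}"
        using finE by (intro card_mono) (auto simp: E'_def)
      then show ?thesis using \<Delta>[of v] that by simp
    qed
  qed (use C1 cE' in auto)
  then obtain \<phi> where \<phi>: "\<phi> ` (V - U) \<subseteq> {1..c}"
    "\<forall>i\<in>{1..c}. k \<le> card {e \<in> E'. \<forall>v\<in>e. \<phi> v = i}"
    unfolding load_colorable_def by blast
  define \<psi> where "\<psi> v = (if v \<in> U then Suc c else \<phi> v)" for v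
  have "\<psi> ` V \<subseteq> {1..Suc c}" using \<phi>(1) by (force simp: \<psi>_def)
  moreover have "k \<le> card {e \<in> E. \<forall>v\<in>e. \<psi> v = i}" if i: "i \<in> {1..Suc c}" for i
  proof (cases "i = Suc c")
    case True
    have "card {e \<in> E. e \<subseteq> U} \<le> card {e \<in> E. \<forall>v\<in>e. \<psi> v = i}"
      using finE True by (intro card_mono) (auto simp: \<psi>_def)
    then show ?thesis using U(2) by linarith
  next
    case False
    have "card {e \<in> E'. \<forall>v\<in>e. \<phi> v = i} \<le> card {e \<in> E. \<forall>v\<in>e. \<psi> v = i}"
      using finE by (intro card_mono) (auto simp: \<psi>_def E'_def)
    then show ?thesis using \<phi>(2) i False by (meson atLeastAtMost_iff le_SucE le_trans)
  qed
  ultimately have "load_colorable (Suc c) k V E" unfolding load_colorable_def by blast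
  then show ?case using load_colorable_mono[OF _ E finE0] by blast
qed

section \<open>Isolated vertices and renaming of vertices\<close>

lemma load_colorable_superset:
  assumes "1 \<le> c" "V \<subseteq> V'" "\<And>e. e \<in> E \<Longrightarrow> e \<subseteq> V"
  shows "load_colorable c k V' E \<longleftrightarrow> load_colorable c k V E"
proof
  assume "load_colorable c k V' E"
  then show "load_colorable c k V E"
    unfolding load_colorable_def using assms(2) by (meson image_mono order_trans)
next
  assume "load_colorable c k V E"
  then obtain \<phi> where \<phi>: "\<phi> ` V \<subseteq> {1..c}"
    "\<forall>i\<in>{1..c}. k \<le> card {e \<in> E. \<forall>v\<in>e. \<phi> v = i}"
    unfolding load_colorable_def by blast
  \<comment> \<open>The vertices outside \<open>V\<close> lie on no edge, so any legal colour will
    do; 1 is legal because \<open>c\<close> is positive.\<close>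
  let ?\<psi> = "\<lambda>v. if v \<in> V then \<phi> v else 1"
  have "{e \<in> E. \<forall>v\<in>e. ?\<psi> v = i} = {e \<in> E. \<forall>v\<in>e. \<phi> v = i}" for i
    using assms(3) by (metis (no_types, opaque_lifting) subsetD)
  then show "load_colorable c k V' E"
    unfolding load_colorable_def using \<phi> assms(1) by (intro exI[of _ ?\<psi>]) auto
qed

lemma load_colorable_image:
  assumes inj: "inj_on f V" and sub: "\<And>e. e \<in> E \<Longrightarrow> e \<subseteq> V"
  shows "load_colorable c k (f ` V) ((`) f ` E) \<longleftrightarrow> load_colorable c k V E"
proof -
  have inj': "inj_on ((`) f) E" using inj sub by (meson inj_onI inj_on_image_eq_iff)
  have card: "card {e \<in> (`) f ` E. \<forall>v\<in>e. \<phi> v = i} = card {e \<in> E. \<forall>v\<in>e. \<phi> (f v) = i}"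
    for \<phi> :: "'b \<Rightarrow> nat" and i
  proof -
    have "{e \<in> (`) f ` E. \<forall>v\<in>e. \<phi> v = i} = (`) f ` {e \<in> E. \<forall>v\<in>e. \<phi> (f v) = i}" by auto
    then show ?thesis using inj' by (metis (no_types, lifting) card_image inj_on_subset mem_Collect_eq subsetI)
  qed
  show ?thesis
  proof
    assume "load_colorable c k (f ` V) ((`) f ` E)"
    then obtain \<phi> :: "'b \<Rightarrow> nat" where \<phi>: "\<phi> ` f ` V \<subseteq> {1..c}"
      "\<forall>i\<in>{1..c}. k \<le> card {e \<in> (`) f ` E. \<forall>v\<in>e. \<phi> v = i}"
      unfolding load_colorable_def by blast
    then show "load_colorable c k V E"
      unfolding load_colorable_def card by (intro exI[of _ "\<lambda>v. \<phi> (f v)"]) auto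
  next
    assume "load_colorable c k V E"
    then obtain \<phi> where \<phi>: "\<phi> ` V \<subseteq> {1..c}"
      "\<forall>i\<in>{1..c}. k \<le> card {e \<in> E. \<forall>v\<in>e. \<phi> v = i}"
      unfolding load_colorable_def by blast
    let ?\<psi> = "\<lambda>v. \<phi> (inv_into V f v)"
    have inv: "inv_into V f (f v) = v" if "v \<in> V" for v using inj that by simp
    have "{e \<in> E. \<forall>v\<in>e. ?\<psi> (f v) = i} = {e \<in> E. \<forall>v\<in>e. \<phi> v = i}" for i
      using sub inv by (metis (no_types, opaque_lifting) subsetD)
    then show "load_colorable c k (f ` V) ((`) f ` E)"
      unfolding load_colorable_def card using \<phi> inv by (intro exI[of _ ?\<psi>]) auto
  qed
qed

section \<open>Greedy edge selection\<close>

definition edges_of :: "(nat \<times> nat) list \<Rightarrow> nat set set" where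
  "edges_of ps = (\<lambda>(a, b). {a, b}) ` set ps"

definition degree_in :: "nat \<Rightarrow> (nat \<times> nat) list \<Rightarrow> nat" where
  "degree_in v ps = length (filter (\<lambda>(a, b). a = v \<or> b = v) ps)"

text \<open>Storing an edge as its increasing pair makes edges and list entries correspond one to
  one, so that edge counts and degrees become lengths of lists.\<close>

definition ordered_pairs :: "nat \<Rightarrow> (nat \<times> nat) list \<Rightarrow> bool" where
  "ordered_pairs n ps \<longleftrightarrow> distinct ps \<and> (\<forall>(a, b)\<in>set ps. a < b \<and> b < n)"

text \<open>The tail is treated first, so the scan runs from the end of the list to its front. As a
  right fold it has the form that \<open>t_greedy\<close> computes on trees.\<close>

fun greedy :: "nat \<Rightarrow> nat \<Rightarrow> (nat \<times> nat) list \<Rightarrow> (nat \<times> nat) list" where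
  "greedy D M [] = []"
| "greedy D M (p # ps) = (let K = greedy D M ps in
     if M \<le> length K \<or> D \<le> degree_in (fst p) K \<or> D \<le> degree_in (snd p) K then K else p # K)"

lemma inj_on_edge:
  assumes "ordered_pairs n ps"
  shows "inj_on (\<lambda>(a, b). {a, b}) (set ps)"
proof -
  have "a < b" if "(a, b) \<in> set ps" for a b
    using assms that unfolding ordered_pairs_def by auto
  then have "\<not> ((a, b) \<in> set ps \<and> (b, a) \<in> set ps)" for a b
    by (meson less_asym)
  then show ?thesis unfolding inj_on_def by (auto simp: doubleton_eq_iff)
qed

lemma simple_graph_edges_of: "ordered_pairs n ps \<Longrightarrow> simple_graph {..<n} (edges_of ps)"
  unfolding ordered_pairs_def simple_graph_def edges_of_def by auto

lemma card_edges_of: "ordered_pairs n ps \<Longrightarrow> card (edges_of ps) = length ps"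
  using inj_on_edge[of n ps]
  by (simp add: edges_of_def card_image ordered_pairs_def distinct_card)

lemma card_incident_edges_of:
  assumes "ordered_pairs n ps"
  shows "card {e \<in> edges_of ps. v \<in> e} = degree_in v ps"
proof -
  let ?qs = "filter (\<lambda>(a, b). a = v \<or> b = v) ps"
  have "{e \<in> edges_of ps. v \<in> e} = edges_of ?qs" by (auto simp: edges_of_def)
  moreover have "ordered_pairs n ?qs" using assms by (auto simp: ordered_pairs_def)
  ultimately show ?thesis using card_edges_of by (simp add: degree_in_def)
qed

lemma set_greedy: "set (greedy D M ps) \<subseteq> set ps"
  by (induction ps) (auto simp: Let_def)

lemma ordered_pairs_greedy: "ordered_pairs n ps \<Longrightarrow> ordered_pairs n (greedy D M ps)"
proof (induction ps)
  case (Cons p ps)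
  then show ?case
    using set_greedy[of D M ps] by (auto simp: ordered_pairs_def Let_def)
qed simp

lemma length_greedy: "length (greedy D M ps) \<le> M"
  by (induction ps) (auto simp: Let_def)

lemma degree_greedy: "degree_in v (greedy D M ps) \<le> D"
  by (induction ps) (auto simp: Let_def degree_in_def)

text \<open>\<open>qs\<close> holds the pairs not yet scanned; they stay in the graph while the tail
  is thinned. A final length below \<open>M\<close> means that the cap was not reached earlier
  either, so every rejected pair had an end with \<open>D\<close> kept edges, and
  \<open>load_colorable_remove_edge\<close> allows it to be dropped.\<close>

lemma greedy_safe:
  assumes "1 \<le> c" "(2 * c - 1) * k \<le> D"
    and "ordered_pairs n (qs @ ps)" "load_colorable c k {..<n} (edges_of (qs @ ps))"
    and "length (greedy D M ps) < M"
  shows "load_colorable c k {..<n} (edges_of (qs @ greedy D M ps))"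
  using assms(3-)
proof (induction ps arbitrary: qs)
  case (Cons p ps)
  let ?K = "greedy D M ps"
  have op: "ordered_pairs n ((qs @ [p]) @ ps)" using Cons.prems(1) by simp
  have lt: "length ?K < M" using Cons.prems(3) by (auto simp: Let_def split: if_splits)
  have "load_colorable c k {..<n} (edges_of ((qs @ [p]) @ ?K))"
    using op Cons.prems(2) lt by (intro Cons.IH) auto
  then have col: "load_colorable c k {..<n} (edges_of (p # qs @ ?K))"
    by (simp add: edges_of_def)
  have opK: "ordered_pairs n (p # qs @ ?K)" "ordered_pairs n (qs @ ?K)"
    using op set_greedy[of D M ps] ordered_pairs_greedy[of n ps D M]
    by (fastforce simp: ordered_pairs_def)+
  show ?case
  proof (cases "D \<le> degree_in (fst p) ?K \<or> D \<le> degree_in (snd p) ?K")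
    case False
    then show ?thesis using col lt by (simp add: Let_def edges_of_def)
  next
    case True
    then obtain v where v: "v = fst p \<or> v = snd p" "D \<le> degree_in v ?K" by blast
    let ?e = "{fst p, snd p}"
    have e: "edges_of (p # qs @ ?K) = insert ?e (edges_of (qs @ ?K))" "?e \<notin> edges_of (qs @ ?K)"
    proof -
      show "edges_of (p # qs @ ?K) = insert ?e (edges_of (qs @ ?K))"
        by (simp add: edges_of_def case_prod_unfold)
      \<comment> \<open>Inserting an edge that is already present would not raise the cardinality,
        but both lists are free of repeated edges and their lengths differ by one.\<close>
      then have "card (insert ?e (edges_of (qs @ ?K))) = Suc (card (edges_of (qs @ ?K)))"
        using card_edges_of[OF opK(1)] card_edges_of[OF opK(2)] by simp
      then show "?e \<notin> edges_of (qs @ ?K)" by (auto simp: insert_absorb)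
    qed
    have "(2 * c - 1) * k \<le> degree_in v (qs @ ?K)"
      using v(2) assms(2) by (simp add: degree_in_def)
    also have "\<dots> = card {e' \<in> edges_of (p # qs @ ?K) - {?e}. v \<in> e'}"
      using e card_incident_edges_of[OF opK(2)] by simp
    finally have "load_colorable c k {..<n} (edges_of (p # qs @ ?K) - {?e})"
      using v e col
      by (intro load_colorable_remove_edge[OF simple_graph_edges_of[OF opK(1)] _ _ assms(1), where v = v]) auto
    then show ?thesis using e True by (simp add: Let_def)
  qed
qed simp

lemma load_colorable_greedy:
  assumes c: "1 \<le> c" and k: "1 \<le> k" and ps: "ordered_pairs n ps"
  shows "load_colorable c k {..<n} (edges_of (greedy ((2 * c - 1) * k) (c * (10 * c - 9) * k) ps)) \<longleftrightarrow>
    load_colorable c k {..<n} (edges_of ps)"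
    (is "load_colorable c k _ (edges_of (greedy ?D ?M ps)) \<longleftrightarrow> _")
proof -
  let ?K = "greedy ?D ?M ps"
  have K: "ordered_pairs n ?K" using ps by (rule ordered_pairs_greedy)
  show ?thesis
  proof
    assume "load_colorable c k {..<n} (edges_of ?K)"
    then show "load_colorable c k {..<n} (edges_of ps)"
      by (rule load_colorable_mono) (simp_all add: edges_of_def image_mono set_greedy)
  next
    assume col: "load_colorable c k {..<n} (edges_of ps)"
    show "load_colorable c k {..<n} (edges_of ?K)"
    proof (cases "length ?K < ?M")
      case True
      then show ?thesis using greedy_safe[OF c order_refl, where qs = "[]" and M = ?M] ps col by simp
    next
      case False
      obtain d where d: "c = Suc d" using c by (cases c) auto
      \<comment> \<open>The cap equals \<open>(c - 1) * 10ck + ck\<close>, which covers the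
        \<open>(c - 1) * 10ck + k\<close> edges that \<open>load_colorable_dense\<close> asks
        for.\<close>
      have "(c - 1) * (10 * c * k) + k \<le> ?M" unfolding d by (simp add: algebra_simps)
      also have "\<dots> \<le> card (edges_of ?K)" using False card_edges_of[OF K] by simp
      finally show ?thesis
        using degree_greedy card_incident_edges_of[OF K]
        by (intro load_colorable_dense[OF order_refl c k simple_graph_edges_of[OF K]]) auto
    qed
  qed
qed

section \<open>The kernel instance built from the kept edges\<close>

text \<open>Vertices are listed in descending order because the right fold in
  \<open>plist_enc_nats\<close> produces the numerals in that order.\<close>

definition candidates :: "nat \<Rightarrow> nat set set \<Rightarrow> (nat \<times> nat) list" where
  "candidates n E = concat (map (\<lambda>i. map (\<lambda>j. (i, j)) (filter (\<lambda>j. i < j \<and> {i, j} \<in> E) (rev [0..<n]))) (rev [0..<n]))"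

lemma distinct_concat_Pair:
  "distinct xs \<Longrightarrow> (\<And>i. distinct (f i)) \<Longrightarrow> distinct (concat (map (\<lambda>i. map (\<lambda>j. (i, j)) (f i)) xs))"
  by (induction xs) (auto simp: distinct_map inj_on_def)

lemma candidates_correct:
  assumes "simple_graph {..<n} E"
  shows "ordered_pairs n (candidates n E)" "edges_of (candidates n E) = E"
proof -
  have s: "set (candidates n E) = {(i, j). i < j \<and> j < n \<and> {i, j} \<in> E}"
    by (auto simp: candidates_def image_iff)
  show "ordered_pairs n (candidates n E)"
    unfolding ordered_pairs_def s by (auto simp: candidates_def intro: distinct_concat_Pair)
  show "edges_of (candidates n E) = E"
  proof (intro equalityI subsetI)
    fix e assume e: "e \<in> E"
    then have "e \<subseteq> {..<n}" "card e = 2" using assms unfolding simple_graph_def by auto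
    then obtain i j where "e = {i, j}" "i < j" "j < n"
      by (auto simp: card_2_iff doubleton_eq_iff) (metis insert_commute nat_neq_iff)
    with e show "e \<in> edges_of (candidates n E)" unfolding edges_of_def s by auto
  qed (auto simp: edges_of_def s)
qed

definition active :: "nat \<Rightarrow> (nat \<times> nat) list \<Rightarrow> nat list" where
  "active n K = filter (\<lambda>v. degree_in v K \<noteq> 0) (rev [0..<n])"

lemma set_active: "ordered_pairs n K \<Longrightarrow> set (active n K) = \<Union>(edges_of K)"
proof -
  assume K: "ordered_pairs n K"
  have "v \<in> set (active n K) \<longleftrightarrow> v < n \<and> (\<exists>p\<in>set K. fst p = v \<or> snd p = v)" for v
    by (auto simp: active_def degree_in_def filter_empty_conv case_prod_unfold)
  also have "\<dots> v \<longleftrightarrow> (\<exists>p\<in>set K. v \<in> {fst p, snd p})" for v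
    using K by (auto simp: ordered_pairs_def case_prod_unfold intro: less_trans)
  finally show ?thesis by (auto simp: edges_of_def case_prod_unfold)
qed

text \<open>An instance must have an initial segment of the naturals as vertex set, so the vertex
  \<open>W ! i\<close> is renamed to \<open>i\<close>.\<close>

definition relabel :: "nat list \<Rightarrow> nat set set \<Rightarrow> nat set set" where
  "relabel W E = {{i, j} | i j. i < length W \<and> j < length W \<and> {W ! i, W ! j} \<in> E}"

text \<open>Indexing into \<open>W\<close> is injective on positions and carries
  \<open>relabel W E\<close> onto \<open>E\<close>, so the claims follow from
  \<open>load_colorable_image\<close> read backwards.\<close>

lemma relabel_correct:
  assumes E: "\<And>e. e \<in> E \<Longrightarrow> e \<subseteq> set W \<and> card e = 2" and W: "distinct W"
  shows "simple_graph {..<length W} (relabel W E)" "card (relabel W E) = card E"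
    "load_colorable c k {..<length W} (relabel W E) \<longleftrightarrow> load_colorable c k (set W) E"
proof -
  have inj: "inj_on ((!) W) {..<length W}" using W by (auto simp: inj_on_def nth_eq_iff_index_eq)
  have img: "(!) W ` {..<length W} = set W" by (auto simp: set_conv_nth)
  have ne: "i \<noteq> j" if "{W ! i, W ! j} \<in> E" for i j using E[OF that] by auto
  show sg: "simple_graph {..<length W} (relabel W E)"
    unfolding simple_graph_def relabel_def by (auto dest: ne)
  have edges: "(`) ((!) W) ` relabel W E = E"
  proof (intro equalityI subsetI)
    fix e assume e: "e \<in> E"
    then obtain x y where xy: "e = {x, y}" using E[OF e] by (auto simp: card_2_iff)
    then obtain i j where "i < length W" "j < length W" "x = W ! i" "y = W ! j"
      using E[OF e] by (auto simp: in_set_conv_nth)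
    with e xy show "e \<in> (`) ((!) W) ` relabel W E"
      unfolding relabel_def by (intro image_eqI[of _ _ "{i, j}"]) auto
  qed (auto simp: relabel_def)
  have sub: "e \<subseteq> {..<length W}" if "e \<in> relabel W E" for e
    using that sg unfolding simple_graph_def by blast
  then have "inj_on ((`) ((!) W)) (relabel W E)"
    using inj by (meson inj_onI inj_on_image_eq_iff)
  then show "card (relabel W E) = card E" using card_image edges by metis
  show "load_colorable c k {..<length W} (relabel W E) \<longleftrightarrow> load_colorable c k (set W) E"
    using load_colorable_image[OF inj sub, of "relabel W E" c k] edges img by simp
qed

definition kernel_list :: "nat \<Rightarrow> lc_instance \<Rightarrow> (nat \<times> nat) list" where
  "kernel_list c = (\<lambda>(n, E, k). greedy ((2 * c - 1) * k) (c * (10 * c - 9) * k) (candidates n E))"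

definition load_kernel :: "nat \<Rightarrow> lc_instance \<Rightarrow> lc_instance" where
  "load_kernel c = (\<lambda>(n, E, k). let K = kernel_list c (n, E, k); W = active n K in
     (length W, relabel W (edges_of K), k))"

lemma load_kernel_correct:
  assumes c: "1 \<le> c" and I: "(n, E, k) \<in> lc_instances" and K: "load_kernel c (n, E, k) = (n', E', k')"
  shows "(n', E', k') \<in> lc_instances"
    "(n, E, k) \<in> LCP c \<longleftrightarrow> (n', E', k') \<in> LCP c"
    "k' = k" "card E' \<le> c * (10 * c - 9) * k" "n' \<le> 2 * (c * (10 * c - 9) * k)"
proof -
  have G: "simple_graph {..<n} E" and k: "1 \<le> k" using I by (auto simp: lc_instances_def)
  define ps where "ps = kernel_list c (n, E, k)"
  define W where "W = active n ps"
  note cand = candidates_correct[OF G]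
  have ps: "ordered_pairs n ps" "length ps \<le> c * (10 * c - 9) * k"
    unfolding ps_def kernel_list_def using ordered_pairs_greedy[OF cand(1)] length_greedy by auto
  have n': "n' = length W" and E': "E' = relabel W (edges_of ps)" and k': "k' = k"
    using K by (auto simp: load_kernel_def W_def ps_def Let_def)
  have W: "set W = \<Union>(edges_of ps)" "distinct W"
    using set_active[OF ps(1)] by (auto simp: W_def active_def)
  have two: "e \<subseteq> {..<n} \<and> card e = 2" if "e \<in> edges_of ps" for e
    using simple_graph_edges_of[OF ps(1)] that unfolding simple_graph_def by blast
  have sub: "e \<subseteq> set W \<and> card e = 2" if "e \<in> edges_of ps" for e
    using that two W(1) by blast
  note rel = relabel_correct[OF sub W(2)]
  show "(n', E', k') \<in> lc_instances"
    using rel(1) k by (simp add: lc_instances_def n' E' k')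
  have Wn: "set W \<subseteq> {..<n}" using W(1) two by blast
  have "load_colorable c k {..<n} E \<longleftrightarrow> load_colorable c k {..<n} (edges_of ps)"
    unfolding ps_def kernel_list_def using load_colorable_greedy[OF c k cand(1)] cand(2) by simp
  also have "\<dots> \<longleftrightarrow> load_colorable c k (set W) (edges_of ps)"
    using sub by (intro load_colorable_superset[OF c Wn]) blast
  also have "\<dots> \<longleftrightarrow> load_colorable c k {..<n'} E'" using rel(3) by (simp add: n' E')
  finally show "(n, E, k) \<in> LCP c \<longleftrightarrow> (n', E', k') \<in> LCP c"
    using \<open>(n', E', k') \<in> lc_instances\<close> I by (simp add: LCP_def k')
  show "k' = k" by (rule k')
  show "card E' \<le> c * (10 * c - 9) * k"
    using rel(2) card_edges_of[OF ps(1)] ps(2) by (simp add: E')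
  \<comment> \<open>Every remaining vertex is an end of a kept edge, so there are at most twice as
    many vertices as kept edges.\<close>
  have "n' = card (set W)" using W(2) by (simp add: n' distinct_card)
  also have "\<dots> \<le> (\<Sum>e\<in>edges_of ps. card e)" unfolding W(1) by (rule card_Union_le_sum_card)
  also have "\<dots> = 2 * length ps" using two card_edges_of[OF ps(1)] by simp
  finally show "n' \<le> 2 * (c * (10 * c - 9) * k)" using ps(2) by simp
qed

section \<open>Polynomial-time tree functions\<close>

lemma poly_nat_mono:
  fixes P :: "nat poly"
  assumes "m \<le> n"
  shows "poly P m \<le> poly P n"
  by (induction P) (use assms in \<open>auto intro!: add_mono mult_mono\<close>)

lemma runs_size:
  assumes "runs p s t s'"
  shows "size (s' x) \<le> size (s x) + t"
  using assms
proof (induction rule: runs.induct)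
qed (auto intro: le_trans)

text \<open>
  The program has to work from an arbitrary store and to leave all variables above \<open>N\<close> alone; they
  can then save intermediate values when programs are composed.
\<close>

definition ptime :: "(tree \<Rightarrow> tree) \<Rightarrow> bool" where
  "ptime f \<longleftrightarrow> (\<exists>p N (P :: nat poly). \<forall>s. \<exists>t s'. runs p s t s' \<and>
     t \<le> poly P (size (s 0)) \<and> s' 0 = f (s 0) \<and> (\<forall>x>N. s' x = s x))"

lemma ptimeI:
  fixes P :: "nat poly"
  assumes "\<And>s. \<exists>t s'. runs p s t s' \<and> t \<le> poly P (size (s 0)) \<and> s' 0 = f (s 0) \<and> (\<forall>x>N. s' x = s x)"
  shows "ptime f"
  using assms unfolding ptime_def by blast

lemma ptimeE:
  assumes "ptime f"
  obtains p and P :: "nat poly" and N where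
    "\<forall>s. \<exists>t s'. runs p s t s' \<and> t \<le> poly P (size (s 0)) \<and> s' 0 = f (s 0) \<and> (\<forall>x>N. s' x = s x)"
  using assms unfolding ptime_def by blast

text \<open>By \<open>runs_size\<close> the output is at most the initial content of variable 0 plus
  the running time.\<close>

lemma ptime_size:
  assumes "ptime f"
  obtains Q :: "nat poly" where "\<forall>e. size (f e) \<le> poly Q (size e)"
proof -
  obtain p N and P :: "nat poly" where *[rule_format]:
    "\<forall>s. \<exists>t s'. runs p s t s' \<and> t \<le> poly P (size (s 0)) \<and> s' 0 = f (s 0) \<and> (\<forall>x>N. s' x = s x)"
    by (rule ptimeE[OF assms])
  have "size (f e) \<le> poly ([:0, 1:] + P) (size e)" for e
  proof -
    obtain t s' where "runs p (\<lambda>_. e) t s'" "t \<le> poly P (size e)" "s' 0 = f e"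
      using *[of "\<lambda>_. e"] by auto
    with runs_size[of p "\<lambda>_. e" t s' 0] show ?thesis by simp
  qed
  then show ?thesis using that by blast
qed

lemma ptime_id: "ptime (\<lambda>e. e)"
  by (rule ptimeI[of Skip "[:1:]" _ 0]) (auto intro!: exI runs.Skip[unfolded One_nat_def])

lemma ptime_comp:
  assumes "ptime g" "ptime f"
  shows "ptime (\<lambda>e. g (f e))"
proof -
  obtain p N and P :: "nat poly" where p[rule_format]:
    "\<forall>s. \<exists>t s'. runs p s t s' \<and> t \<le> poly P (size (s 0)) \<and> s' 0 = f (s 0) \<and> (\<forall>x>N. s' x = s x)"
    by (rule ptimeE[OF assms(2)])
  obtain q M and Q :: "nat poly" where q[rule_format]:
    "\<forall>s. \<exists>t s'. runs q s t s' \<and> t \<le> poly Q (size (s 0)) \<and> s' 0 = g (s 0) \<and> (\<forall>x>M. s' x = s x)"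
    by (rule ptimeE[OF assms(1)])
  obtain R :: "nat poly" where R[rule_format]: "\<forall>e. size (f e) \<le> poly R (size e)"
    by (rule ptime_size[OF assms(2)])
  show ?thesis
  proof (rule ptimeI[of "Seq p q" "P + pcompose Q R" _ "max N M"])
    fix s
    obtain t s' where 1: "runs p s t s'" "t \<le> poly P (size (s 0))" "s' 0 = f (s 0)" "\<forall>x>N. s' x = s x"
      using p by blast
    obtain u s'' where 2: "runs q s' u s''" "u \<le> poly Q (size (s' 0))" "s'' 0 = g (s' 0)" "\<forall>x>M. s'' x = s' x"
      using q by blast
    have "u \<le> poly (pcompose Q R) (size (s 0))"
      using 2(2) poly_nat_mono[OF R, of Q "s 0"] 1(3) by (simp add: poly_pcompose)
    then show "\<exists>t s'. runs (Seq p q) s t s' \<and> t \<le> poly (P + pcompose Q R) (size (s 0)) \<and>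
        s' 0 = g (f (s 0)) \<and> (\<forall>x>max N M. s' x = s x)"
      using runs.Seq[OF 1(1) 2(1)] 1 2 by (intro exI[of _ "t + u"] exI[of _ s'']) auto
  qed
qed

lemma ptime_left: "ptime f \<Longrightarrow> ptime (\<lambda>e. left (f e))"
proof (erule ptime_comp[rotated], rule ptimeI[of "Assign 0 (First (Var 0))" "[:1, 1:]" _ 0])
  fix s :: store
  have "size (left (s 0)) \<le> size (s 0)" by (cases "s 0") auto
  then show "\<exists>t s'. runs (Assign 0 (First (Var 0))) s t s' \<and> t \<le> poly [:1, 1:] (size (s 0)) \<and>
      s' 0 = left (s 0) \<and> (\<forall>x>0. s' x = s x)"
    using runs.Assign[of 0 "First (Var 0)" s]
    by (intro exI[of _ "1 + size (left (s 0))"] exI[of _ "s(0 := left (s 0))"]) auto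
qed

lemma ptime_right: "ptime f \<Longrightarrow> ptime (\<lambda>e. right (f e))"
proof (erule ptime_comp[rotated], rule ptimeI[of "Assign 0 (Second (Var 0))" "[:1, 1:]" _ 0])
  fix s :: store
  have "size (right (s 0)) \<le> size (s 0)" by (cases "s 0") auto
  then show "\<exists>t s'. runs (Assign 0 (Second (Var 0))) s t s' \<and> t \<le> poly [:1, 1:] (size (s 0)) \<and>
      s' 0 = right (s 0) \<and> (\<forall>x>0. s' x = s x)"
    using runs.Assign[of 0 "Second (Var 0)" s]
    by (intro exI[of _ "1 + size (right (s 0))"] exI[of _ "s(0 := right (s 0))"]) auto
qed

lemma ptime_Leaf: "ptime (\<lambda>e. Leaf)"
proof (rule ptimeI[of "Assign 0 Empty" "[:1:]" _ 0])
  fix s :: store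
  show "\<exists>t s'. runs (Assign 0 Empty) s t s' \<and> t \<le> poly [:1:] (size (s 0)) \<and>
      s' 0 = Leaf \<and> (\<forall>x>0. s' x = s x)"
    using runs.Assign[of 0 "Empty" s]
    by (intro exI[of _ 1] exI[of _ "s(0 := Leaf)"]) auto
qed

text \<open>The first program overwrites the input in variable 0. The input is therefore saved in
  \<open>N + 1\<close>, and the first result in \<open>N + 2\<close> while the second program runs;
  neither program touches variables above \<open>N\<close>.\<close>

lemma ptime_Node:
  assumes "ptime f" "ptime g"
  shows "ptime (\<lambda>e. Node (f e) (g e))"
proof -
  obtain p N0 and P :: "nat poly" where p[rule_format]:
    "\<forall>s. \<exists>t s'. runs p s t s' \<and> t \<le> poly P (size (s 0)) \<and> s' 0 = f (s 0) \<and> (\<forall>x>N0. s' x = s x)"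
    by (rule ptimeE[OF assms(1)])
  obtain q M0 and Q :: "nat poly" where q[rule_format]:
    "\<forall>s. \<exists>t s'. runs q s t s' \<and> t \<le> poly Q (size (s 0)) \<and> s' 0 = g (s 0) \<and> (\<forall>x>M0. s' x = s x)"
    by (rule ptimeE[OF assms(2)])
  obtain R where R[rule_format]: "\<forall>e. size (f e) \<le> poly R (size e)" by (rule ptime_size[OF assms(1)])
  obtain R' where R'[rule_format]: "\<forall>e. size (g e) \<le> poly R' (size e)" by (rule ptime_size[OF assms(2)])
  define N where "N = max N0 M0"
  let ?c1 = "Assign (N + 1) (Var 0)"
  let ?c3 = "Assign (N + 2) (Var 0)"
  let ?c4 = "Assign 0 (Var (N + 1))"
  let ?c6 = "Assign 0 (Pair (Var (N + 2)) (Var 0))"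
  show ?thesis
  proof (rule ptimeI[of "Seq ?c1 (Seq p (Seq ?c3 (Seq ?c4 (Seq q ?c6))))"
        "[:5, 2:] + P + R + Q + R + R'" _ "N + 2"])
    fix s :: store
    let ?e = "s 0"
    let ?s1 = "s(N + 1 := ?e)"
    have r1: "runs ?c1 s (1 + size ?e) ?s1"
      using runs.Assign[of "N + 1" "Var 0" s] by simp
    obtain t2 s2 where r2: "runs p ?s1 t2 s2" "t2 \<le> poly P (size ?e)" "s2 0 = f ?e" "\<forall>x>N. s2 x = ?s1 x"
      using p[of ?s1] by (auto simp: N_def)
    let ?s3 = "s2(N + 2 := f ?e)"
    have r3: "runs ?c3 s2 (1 + size (f ?e)) ?s3"
      using runs.Assign[of "N + 2" "Var 0" s2] r2 by simp
    let ?s4 = "?s3(0 := ?e)"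
    have r4: "runs ?c4 ?s3 (1 + size ?e) ?s4"
      using runs.Assign[of 0 "Var (N + 1)" ?s3] r2 by simp
    obtain t5 s5 where r5: "runs q ?s4 t5 s5" "t5 \<le> poly Q (size ?e)" "s5 0 = g ?e" "\<forall>x>N. s5 x = ?s4 x"
      using q[of ?s4] by (auto simp: N_def)
    let ?s6 = "s5(0 := Node (f ?e) (g ?e))"
    have r6: "runs ?c6 s5 (2 + size (f ?e) + size (g ?e)) ?s6"
      using runs.Assign[of 0 "Pair (Var (N + 2)) (Var 0)" s5] r5 by simp
    show "\<exists>t s'. runs (Seq ?c1 (Seq p (Seq ?c3 (Seq ?c4 (Seq q ?c6))))) s t s' \<and>
        t \<le> poly ([:5, 2:] + P + R + Q + R + R') (size ?e) \<and>
        s' 0 = Node (f ?e) (g ?e) \<and> (\<forall>x>N + 2. s' x = s x)"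
      apply (intro exI conjI)
         apply (rule runs.Seq[OF r1 runs.Seq[OF r2(1) runs.Seq[OF r3 runs.Seq[OF r4 runs.Seq[OF r5(1) r6]]]]])
      using r2 r5 R[of ?e] R'[of ?e] by auto
  qed
qed

lemma ptime_const: "ptime (\<lambda>e. t)"
  by (induction t) (auto intro: ptime_Leaf ptime_Node)

text \<open>The value of the test and the input are first packed into one tree. \<open>?h\<close>
  then branches on the left part and runs the chosen program on the right part.\<close>

lemma ptime_if:
  assumes "ptime b" "ptime f" "ptime g"
  shows "ptime (\<lambda>e. if b e = Leaf then f e else g e)"
proof -
  obtain p N0 and P :: "nat poly" where p[rule_format]:
    "\<forall>s. \<exists>t s'. runs p s t s' \<and> t \<le> poly P (size (s 0)) \<and> s' 0 = f (s 0) \<and> (\<forall>x>N0. s' x = s x)"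
    by (rule ptimeE[OF assms(2)])
  obtain q M0 and Q :: "nat poly" where q[rule_format]:
    "\<forall>s. \<exists>t s'. runs q s t s' \<and> t \<le> poly Q (size (s 0)) \<and> s' 0 = g (s 0) \<and> (\<forall>x>M0. s' x = s x)"
    by (rule ptimeE[OF assms(3)])
  define N where "N = max N0 M0"
  let ?h = "\<lambda>z. if left z = Leaf then f (right z) else g (right z)"
  let ?a = "Assign 0 (Second (Var 0))"
  let ?c = "Cond (First (Var 0)) (Seq ?a q) (Seq ?a p)"
  have "ptime ?h"
  proof (rule ptimeI[of ?c "[:2, 1:] + P + Q" _ N])
    fix s :: store
    let ?e = "right (s 0)"
    have sz: "size ?e \<le> size (s 0)" by (cases "s 0") auto
    let ?s1 = "s(0 := ?e)"
    have r1: "runs ?a s (1 + size ?e) ?s1"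
      using runs.Assign[of 0 "Second (Var 0)" s] by simp
    show "\<exists>t s'. runs ?c s t s' \<and> t \<le> poly ([:2, 1:] + P + Q) (size (s 0)) \<and>
        s' 0 = ?h (s 0) \<and> (\<forall>x>N. s' x = s x)"
    proof (cases "left (s 0) = Leaf")
      case True
      obtain t s' where r: "runs p ?s1 t s'" "t \<le> poly P (size ?e)" "s' 0 = f ?e" "\<forall>x>N. s' x = ?s1 x"
        using p[of ?s1] by (auto simp: N_def)
      have "runs ?c s (1 + (1 + size ?e + t)) s'"
        using True by (intro runs.CondFalse runs.Seq[OF r1 r(1)]) simp
      then show ?thesis
        using r sz True poly_nat_mono[OF sz, of P]
        by (intro exI[of _ "1 + (1 + size ?e + t)"] exI[of _ s']) auto
    next
      case False
      obtain t s' where r: "runs q ?s1 t s'" "t \<le> poly Q (size ?e)" "s' 0 = g ?e" "\<forall>x>N. s' x = ?s1 x"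
        using q[of ?s1] by (auto simp: N_def)
      have "runs ?c s (1 + (1 + size ?e + t)) s'"
        using False by (intro runs.CondTrue runs.Seq[OF r1 r(1)]) simp
      then show ?thesis
        using r sz False poly_nat_mono[OF sz, of Q]
        by (intro exI[of _ "1 + (1 + size ?e + t)"] exI[of _ s']) auto
    qed
  qed
  from ptime_comp[OF this ptime_Node[OF assms(1) ptime_id]] show ?thesis by (simp cong: if_cong)
qed

section \<open>Trees as lists, and iteration over lists\<close>

text \<open>Every tree is a list along its right spine, so this decoding is total and a two-sided
  inverse of \<open>enc_list\<close>.\<close>

fun list_of :: "tree \<Rightarrow> tree list" where
  "list_of Leaf = []"
| "list_of (Node x xs) = x # list_of xs"

lemma enc_list_of [simp]: "enc_list (list_of t) = t"
  by (induction t) auto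

lemma list_of_enc [simp]: "list_of (enc_list xs) = xs"
  by (induction xs) auto

lemma size_enc_list: "size (enc_list xs) = sum_list (map size xs) + length xs"
  by (induction xs) auto

text \<open>Iterating a polynomial-time step could make the accumulator explode. The hypothesis
  bounds it after every prefix of the list, so each round costs polynomial time, and the number of
  rounds is at most the size of the list.\<close>

lemma ptime_fold_aux:
  assumes step: "ptime step" and init: "ptime init" and lst: "ptime lst"
    and bound: "\<And>e n. size (fold (\<lambda>x a. step (Node e (Node x a))) (take n (list_of (lst e))) (init e))
      \<le> poly Q (size e)"
  shows "ptime (\<lambda>e. fold (\<lambda>x a. step (Node e (Node x a))) (list_of (lst e)) (init e))"
proof -
  obtain p N0 and P :: "nat poly" where p[rule_format]:
    "\<forall>s. \<exists>t s'. runs p s t s' \<and> t \<le> poly P (size (s 0)) \<and> s' 0 = step (s 0) \<and> (\<forall>x>N0. s' x = s x)"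
    by (rule ptimeE[OF step])
  obtain q M0 and R :: "nat poly" where q[rule_format]:
    "\<forall>s. \<exists>t s'. runs q s t s' \<and> t \<le> poly R (size (s 0)) \<and>
       s' 0 = Node (s 0) (Node (init (s 0)) (lst (s 0))) \<and> (\<forall>x>M0. s' x = s x)"
    by (rule ptimeE[OF ptime_Node[OF ptime_id ptime_Node[OF init lst]]])
  obtain I where I[rule_format]: "\<forall>e. size (init e) \<le> poly I (size e)" by (rule ptime_size[OF init])
  obtain L where L[rule_format]: "\<forall>e. size (lst e) \<le> poly L (size e)" by (rule ptime_size[OF lst])
  define N where "N = max N0 M0"
  let ?f = "\<lambda>e x a. step (Node e (Node x a))"
  let ?ve = "N + 1" and ?va = "N + 2" and ?vl = "N + 3"
  let ?b1 = "Assign 0 (Pair (Var ?ve) (Pair (First (Var ?vl)) (Var ?va)))"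
  let ?b2 = "Assign ?va (Var 0)"
  let ?b3 = "Assign ?vl (Second (Var ?vl))"
  let ?body = "Seq ?b1 (Seq p (Seq ?b2 ?b3))"
  let ?loop = "While (Var ?vl) ?body"
  \<comment> \<open>\<open>K\<close> bounds the environment and the list, \<open>B\<close> every
    accumulator. One round makes one test, stores a pair of size at most \<open>2 + 2K + B\<close>,
    runs \<open>p\<close> on it and saves the new accumulator and the tail; the leading 1 pays for
    the last, failing test.\<close>
  have loop: "\<exists>t s'. runs ?loop s t s' \<and>
      t \<le> 1 + length xs * (6 + 3 * K + 2 * B + poly P (2 + K + K + B)) \<and>
      s' ?va = fold (?f e) xs (s ?va) \<and> (\<forall>x>N + 3. s' x = s x)"
    if "s ?vl = enc_list xs" "s ?ve = e" "size e \<le> K" "size (enc_list xs) \<le> K"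
      "\<And>n. size (fold (?f e) (take n xs) (s ?va)) \<le> B" for s xs e K B
    using that
  proof (induction xs arbitrary: s)
    case Nil
    then show ?case
      using runs.WhileFalse[of "Var ?vl" s ?body] by (intro exI[of _ 1] exI[of _ s]) auto
  next
    case (Cons x xs)
    let ?a = "s ?va"
    let ?z = "Node e (Node x ?a)"
    \<comment> \<open>The prefixes of length 0 and 1 give the bounds before and after this
      round.\<close>
    have sa: "size ?a \<le> B" using Cons.prems(5)[of 0] by simp
    have sfa: "size (step ?z) \<le> B" using Cons.prems(5)[of 1] by simp
    have sx: "size x \<le> K" "size (enc_list xs) \<le> K" using Cons.prems(4) by auto
    let ?s1 = "s(0 := ?z)"
    have r1: "runs ?b1 s (3 + size e + size x + size ?a) ?s1"
      using runs.Assign[of 0 "Pair (Var ?ve) (Pair (First (Var ?vl)) (Var ?va))" s] Cons.prems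
      by (simp add: numeral_3_eq_3 add.assoc)
    obtain t2 s2 where r2: "runs p ?s1 t2 s2" "t2 \<le> poly P (size ?z)" "s2 0 = step ?z"
        "\<forall>x>N. s2 x = ?s1 x"
      using p[of ?s1] by (auto simp: N_def)
    let ?s3 = "s2(?va := step ?z)"
    have r3: "runs ?b2 s2 (1 + size (step ?z)) ?s3"
      using runs.Assign[of ?va "Var 0" s2] r2 by simp
    let ?s4 = "?s3(?vl := enc_list xs)"
    have r4: "runs ?b3 ?s3 (1 + size (enc_list xs)) ?s4"
      using runs.Assign[of ?vl "Second (Var ?vl)" ?s3] r2 Cons.prems by simp
    have body: "runs ?body s (3 + size e + size x + size ?a + (t2 + (1 + size (step ?z) + (1 + size (enc_list xs))))) ?s4"
      by (rule runs.Seq[OF r1 runs.Seq[OF r2(1) runs.Seq[OF r3 r4]]])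
    have "\<exists>t s'. runs ?loop ?s4 t s' \<and>
      t \<le> 1 + length xs * (6 + 3 * K + 2 * B + poly P (2 + K + K + B)) \<and>
      s' ?va = fold (?f e) xs (?s4 ?va) \<and> (\<forall>x>N + 3. s' x = ?s4 x)"
    proof (rule Cons.IH)
      show "size (fold (?f e) (take n xs) (?s4 ?va)) \<le> B" for n
        using Cons.prems(5)[of "Suc n"] by simp
    qed (use Cons.prems r2 sx in auto)
    then obtain t5 s5 where r5: "runs ?loop ?s4 t5 s5"
      "t5 \<le> 1 + length xs * (6 + 3 * K + 2 * B + poly P (2 + K + K + B))"
      "s5 ?va = fold (?f e) xs (step ?z)" "\<forall>x>N + 3. s5 x = ?s4 x"
      by auto
    have t2: "t2 \<le> poly P (2 + K + K + B)"
      using r2(2) poly_nat_mono[of "size ?z" "2 + K + K + B" P] sx sa Cons.prems(3) by simp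
    have "runs ?loop s (1 + (3 + size e + size x + size ?a + (t2 + (1 + size (step ?z) + (1 + size (enc_list xs))))) + t5) s5"
      using Cons.prems(1) by (intro runs.WhileTrue[OF _ body r5(1)]) simp
    moreover have "1 + (3 + size e + size x + size ?a + (t2 + (1 + size (step ?z) + (1 + size (enc_list xs))))) + t5
      \<le> 1 + length (x # xs) * (6 + 3 * K + 2 * B + poly P (2 + K + K + B))"
      using t2 r5(2) sx sa sfa Cons.prems(3) by simp
    moreover have "\<forall>x>N + 3. s5 x = s x"
      using r5(4) r2(4) by auto
    ultimately show ?case
      using r5(3) by (intro exI[of _ "1 + (3 + size e + size x + size ?a + (t2 + (1 + size (step ?z) + (1 + size (enc_list xs))))) + t5"]
        exI[of _ s5]) (simp del: length_Cons)
  qed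
  let ?prep = "Assign ?ve (First (Var 0))"
  let ?c2 = "Assign ?va (First (Second (Var 0)))"
  let ?c3 = "Assign ?vl (Second (Second (Var 0)))"
  let ?c5 = "Assign 0 (Var ?va)"
  let ?prog = "Seq q (Seq ?prep (Seq ?c2 (Seq ?c3 (Seq ?loop ?c5))))"
  \<comment> \<open>\<open>KP\<close> bounds the environment and the list together; \<open>W\<close>
    is the cost of one round as a polynomial in the input size.\<close>
  define KP where "KP = [:0, 1:] + L"
  define W where "W = [:6:] + [:3:] * KP + [:2:] * Q + pcompose P ([:2:] + KP + KP + Q)"
  show ?thesis
  proof (rule ptimeI[of ?prog "R + [:5, 1:] + I + L + L * W + Q" _ "N + 3"])
    fix s :: store
    let ?e = "s 0"
    let ?r = "fold (?f ?e) (list_of (lst ?e)) (init ?e)"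
    obtain t1 s1 where r1: "runs q s t1 s1" "t1 \<le> poly R (size ?e)"
      "s1 0 = Node ?e (Node (init ?e) (lst ?e))" "\<forall>x>N. s1 x = s x"
      using q[of s] by (auto simp: N_def)
    let ?s2 = "s1(?ve := ?e)"
    have r2: "runs ?prep s1 (1 + size ?e) ?s2"
      using runs.Assign[of ?ve "First (Var 0)" s1] r1 by simp
    let ?s3 = "?s2(?va := init ?e)"
    have r3: "runs ?c2 ?s2 (1 + size (init ?e)) ?s3"
      using runs.Assign[of ?va "First (Second (Var 0))" ?s2] r1 by simp
    let ?s4 = "?s3(?vl := lst ?e)"
    have r4: "runs ?c3 ?s3 (1 + size (lst ?e)) ?s4"
      using runs.Assign[of ?vl "Second (Second (Var 0))" ?s3] r1 by simp
    let ?K = "poly KP (size ?e)"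
    have "\<exists>t s'. runs ?loop ?s4 t s' \<and>
      t \<le> 1 + length (list_of (lst ?e)) * (6 + 3 * ?K + 2 * poly Q (size ?e) + poly P (2 + ?K + ?K + poly Q (size ?e))) \<and>
      s' ?va = fold (?f ?e) (list_of (lst ?e)) (?s4 ?va) \<and> (\<forall>x>N + 3. s' x = ?s4 x)"
      by (rule loop) (use bound L[of ?e] in \<open>auto simp: KP_def intro: le_trans\<close>)
    then obtain t5 s5 where r5: "runs ?loop ?s4 t5 s5"
      "t5 \<le> 1 + length (list_of (lst ?e)) * poly W (size ?e)"
      "s5 ?va = ?r" "\<forall>x>N + 3. s5 x = ?s4 x"
      by (auto simp: W_def poly_pcompose add_ac mult_ac)
    have "length (list_of (lst ?e)) \<le> size (lst ?e)"
      using size_enc_list[of "list_of (lst ?e)"] by simp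
    then have "length (list_of (lst ?e)) * poly W (size ?e) \<le> poly L (size ?e) * poly W (size ?e)"
      using L[of ?e] by (intro mult_right_mono) auto
    then have t5: "t5 \<le> 1 + poly L (size ?e) * poly W (size ?e)" using r5(2) by linarith
    have sr: "size ?r \<le> poly Q (size ?e)"
      using bound[of ?e "length (list_of (lst ?e))"] by simp
    have r6: "runs ?c5 s5 (1 + size ?r) (s5(0 := ?r))"
      using runs.Assign[of 0 "Var ?va" s5] r5(3) by simp
    let ?t = "t1 + ((1 + size ?e) + ((1 + size (init ?e)) + ((1 + size (lst ?e)) + (t5 + (1 + size ?r)))))"
    have "runs ?prog s ?t (s5(0 := ?r))"
      by (rule runs.Seq[OF r1(1) runs.Seq[OF r2 runs.Seq[OF r3 runs.Seq[OF r4 runs.Seq[OF r5(1) r6]]]]])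
    moreover have "?t \<le> poly (R + [:5, 1:] + I + L + L * W + Q) (size ?e)"
      using r1(2) I[of ?e] L[of ?e] t5 sr by simp
    moreover have "\<forall>x>N + 3. (s5(0 := ?r)) x = s x" using r5(4) r1(4) by auto
    ultimately show "\<exists>t s'. runs ?prog s t s' \<and> t \<le> poly (R + [:5, 1:] + I + L + L * W + Q) (size ?e) \<and>
      s' 0 = ?r \<and> (\<forall>x>N + 3. s' x = s x)"
      by (intro exI[of _ ?t] exI[of _ "s5(0 := ?r)"]) simp
  qed
qed

lemma poly_nat_le: "m \<le> n \<Longrightarrow> a \<le> poly P m \<Longrightarrow> a \<le> poly (P :: nat poly) n"
  using poly_nat_mono le_trans by blast

section \<open>Lists, unary numbers and decidable predicates\<close>

definition plist :: "(tree \<Rightarrow> tree list) \<Rightarrow> bool" where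
  "plist l \<longleftrightarrow> ptime (\<lambda>e. enc_list (l e))"

text \<open>In unary a number is a list of \<open>Leaf\<close>, so arithmetic reduces to list
  operations. As \<open>Leaf\<close> has size 0, the tree for \<open>n\<close> has size
  \<open>n\<close>.\<close>

definition enc_nat :: "nat \<Rightarrow> tree" where
  "enc_nat n = enc_list (replicate n Leaf)"

definition nat_of :: "tree \<Rightarrow> nat" where
  "nat_of t = length (list_of t)"

definition pnat :: "(tree \<Rightarrow> nat) \<Rightarrow> bool" where
  "pnat n \<longleftrightarrow> ptime (\<lambda>e. enc_nat (n e))"

definition pdec :: "(tree \<Rightarrow> bool) \<Rightarrow> bool" where
  "pdec P \<longleftrightarrow> ptime (\<lambda>e. enc_bool (P e))"

lemma nat_of_enc_nat [simp]: "nat_of (enc_nat n) = n"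
  by (simp add: nat_of_def enc_nat_def)

lemma plist_list_of: "ptime f \<Longrightarrow> plist (\<lambda>e. list_of (f e))"
  by (simp add: plist_def)

lemma plist_rev:
  assumes "plist l"
  shows "plist (\<lambda>e. rev (l e))"
proof -
  obtain Q :: "nat poly" where Q: "\<forall>e. size (enc_list (l e)) \<le> poly Q (size e)"
    by (rule ptime_size[OF assms[unfolded plist_def]])
  have *: "fold Node xs (enc_list ys) = enc_list (rev xs @ ys)" for xs ys
    by (induction xs arbitrary: ys) (simp_all flip: enc_list.simps(2))
  have **: "fold Node xs Leaf = enc_list (rev xs)" for xs
    using *[of xs "[]"] by simp
  have "sum_list (map size (take n xs)) \<le> sum_list (map size xs)" for xs :: "tree list" and n
  proof -
    have "sum_list (map size xs) = sum_list (map size (take n xs @ drop n xs))" by simp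
    then show ?thesis unfolding map_append sum_list_append by simp
  qed
  then have "size (enc_list (rev (take n xs))) \<le> size (enc_list xs)" for xs n
    by (simp add: size_enc_list rev_map[symmetric] add_mono)
  then have "size (enc_list (rev (take n (l e)))) \<le> poly Q (size e)" for n e
    using Q le_trans by blast
  \<comment> \<open>Projecting away the environment leaves \<open>Node x a\<close>, so the step is a
    cons and the partial results are reversed prefixes.\<close>
  then have "ptime (\<lambda>e. fold (\<lambda>x a. right (Node e (Node x a))) (list_of (enc_list (l e))) Leaf)"
    using assms unfolding plist_def
    by (intro ptime_fold_aux[where Q = Q] ptime_right ptime_id ptime_const) (auto simp: **)
  then show ?thesis by (simp add: ** plist_def)
qed

text \<open>
  Here and below, a function \<open>g e x\<close> of an environment and a list element counts as polynomial-time
  if it is so as a function of the single tree \<open>Node e x\<close>.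
\<close>

lemma ptime_foldr:
  assumes step: "ptime (\<lambda>z. S (left z) (left (right z)) (right (right z)))"
    and l: "plist l" and init: "ptime a"
    and bound: "\<And>e xs. size (foldr (S e) xs (a e)) \<le> poly Q (size e + size (enc_list xs))"
  shows "ptime (\<lambda>e. foldr (S e) (l e) (a e))"
proof -
  obtain L :: "nat poly" where L: "\<forall>e. size (enc_list (l e)) \<le> poly L (size e)"
    by (rule ptime_size[OF l[unfolded plist_def]])
  let ?s = "\<lambda>z. S (left z) (left (right z)) (right (right z))"
  let ?Q = "pcompose Q ([:0, 1:] + L)"
  have "ptime (\<lambda>e. fold (\<lambda>x a. ?s (Node e (Node x a))) (list_of (enc_list (rev (l e)))) (a e))"
  proof (rule ptime_fold_aux[OF step init, where Q = ?Q])
    show "ptime (\<lambda>e. enc_list (rev (l e)))" using plist_rev[OF l] by (simp add: plist_def)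
    fix e n
    let ?ys = "drop (length (l e) - n) (l e)"
    have "sum_list (map size (l e)) = sum_list (map size (take (length (l e) - n) (l e) @ ?ys))" by simp
    then have "sum_list (map size ?ys) \<le> sum_list (map size (l e))"
      unfolding map_append sum_list_append by simp
    then have "size (enc_list ?ys) \<le> size (enc_list (l e))"
      by (simp add: size_enc_list add_mono)
    also have "\<dots> \<le> poly L (size e)" using L by blast
    finally have "size (foldr (S e) ?ys (a e)) \<le> poly Q (size e + poly L (size e))"
      by (intro poly_nat_le[OF _ bound]) simp
    moreover have "fold (S e) (take n (rev (l e))) (a e) = foldr (S e) ?ys (a e)"
      by (simp add: foldr_conv_fold take_rev)
    ultimately show "size (fold (\<lambda>x a. ?s (Node e (Node x a))) (take n (list_of (enc_list (rev (l e))))) (a e))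
        \<le> poly ?Q (size e)"
      by (simp add: poly_pcompose)
  qed
  then show ?thesis by (simp add: foldr_conv_fold)
qed

text \<open>If the growth in one step depends on the environment and the element but not on the
  accumulator, it only adds up along the list and the total stays polynomial.\<close>

lemma ptime_foldr_additive:
  assumes step: "ptime (\<lambda>z. S (left z) (left (right z)) (right (right z)))"
    and l: "plist l" and init: "ptime a"
    and growth: "\<And>e x b. size (S e x b) \<le> size b + poly Q (size e + size x)"
  shows "ptime (\<lambda>e. foldr (S e) (l e) (a e))"
proof -
  obtain A :: "nat poly" where A: "\<forall>e. size (a e) \<le> poly A (size e)"
    by (rule ptime_size[OF init])
  have "size (foldr (S e) xs (a e)) \<le> poly (A + [:0, 1:] * Q) (size e + size (enc_list xs))" for e xs
  proof -
    \<comment> \<open>The comparison list \<open>ys\<close> stays fixed while \<open>xs\<close>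
      shrinks, so all steps share one bound.\<close>
    have "size (foldr (S e) xs (a e)) \<le> size (a e) + length xs * poly Q (size e + size (enc_list ys))"
      if "set xs \<subseteq> set ys" for ys
      using that
    proof (induction xs)
      case (Cons x xs)
      have "size x \<le> size (enc_list ys)"
        using Cons.prems by (simp add: size_enc_list trans_le_add1 member_le_sum_list)
      then have "poly Q (size e + size x) \<le> poly Q (size e + size (enc_list ys))"
        by (intro poly_nat_mono) simp
      then show ?case
        using growth[of e x "foldr (S e) xs (a e)"] Cons by simp
    qed simp
    from this[of xs] have "size (foldr (S e) xs (a e)) \<le>
        size (a e) + length xs * poly Q (size e + size (enc_list xs))" by simp
    also have "\<dots> \<le> poly A (size e + size (enc_list xs)) +
        (size e + size (enc_list xs)) * poly Q (size e + size (enc_list xs))"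
    proof (rule add_mono[OF _ mult_right_mono])
      show "size (a e) \<le> poly A (size e + size (enc_list xs))"
        by (rule poly_nat_le[OF _ A[rule_format]]) simp
    qed (simp_all add: size_enc_list)
    finally show ?thesis by simp
  qed
  with step l init show ?thesis by (rule ptime_foldr)
qed

lemma plist_map:
  assumes g: "ptime (\<lambda>z. g (left z) (right z))" and l: "plist l"
  shows "plist (\<lambda>e. map (g e) (l e))"
proof -
  obtain Q :: "nat poly" where Q: "\<forall>z. size (g (left z) (right z)) \<le> poly Q (size z)"
    by (rule ptime_size[OF g])
  have Q': "size (g e x) \<le> poly Q (Suc (size e + size x))" for e x
    using Q[rule_format, of "Node e x"] by simp
  have "ptime (\<lambda>z. (\<lambda>z. g (left z) (right z)) (Node (left z) (left (right z))))"
    by (rule ptime_comp[OF g]) (intro ptime_Node ptime_left ptime_right ptime_id)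
  then have "ptime (\<lambda>e. foldr (\<lambda>x b. Node (g e x) b) (l e) Leaf)"
    \<comment> \<open>One step adds a new node and the image of \<open>Node e x\<close>, a tree of
      size one more than \<open>e\<close> and \<open>x\<close> together.\<close>
    using l by (intro ptime_foldr_additive[where Q = "[:1:] + pcompose Q [:1, 1:]"])
      (auto intro!: ptime_Node ptime_right ptime_id ptime_const Q' simp: poly_pcompose)
  moreover have "foldr (\<lambda>x b. Node (g e x) b) xs Leaf = enc_list (map (g e) xs)" for e xs
    by (induction xs) auto
  ultimately show ?thesis by (simp add: plist_def)
qed

lemma ptime_enc_bool: "pdec P \<Longrightarrow> ptime (\<lambda>e. enc_bool (P e))"
  by (simp add: pdec_def)

lemma ptime_ite:
  assumes "pdec P" "ptime f" "ptime g"
  shows "ptime (\<lambda>e. if P e then f e else g e)"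
proof -
  have "(\<lambda>e. if enc_bool (P e) = Leaf then g e else f e) = (\<lambda>e. if P e then f e else g e)"
    by (auto simp: enc_bool_def)
  with ptime_if[OF assms(1)[unfolded pdec_def] assms(3,2)] show ?thesis by simp
qed

lemma pdec_conj:
  assumes "pdec P" "pdec Q"
  shows "pdec (\<lambda>e. P e \<and> Q e)"
proof -
  have "enc_bool (p \<and> q) = (if p then enc_bool q else Leaf)" for p q by (simp add: enc_bool_def)
  then show ?thesis
    using ptime_ite[OF assms(1) assms(2)[unfolded pdec_def] ptime_const] by (simp add: pdec_def)
qed

lemma pdec_not:
  assumes "pdec P"
  shows "pdec (\<lambda>e. \<not> P e)"
proof -
  have "enc_bool (\<not> p) = (if p then Leaf else Node Leaf Leaf)" for p by (simp add: enc_bool_def)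
  then show ?thesis
    using ptime_ite[OF assms ptime_const ptime_const] by (simp add: pdec_def)
qed

lemma pdec_disj: "pdec P \<Longrightarrow> pdec Q \<Longrightarrow> pdec (\<lambda>e. P e \<or> Q e)"
  using pdec_not[OF pdec_conj[OF pdec_not pdec_not], of P Q] by simp

lemma pdec_eq_Leaf:
  assumes "ptime f"
  shows "pdec (\<lambda>e. f e = Leaf)"
  using ptime_if[OF assms ptime_const[of "Node Leaf Leaf"] ptime_const[of Leaf]]
  by (simp add: pdec_def enc_bool_def)

lemma pdec_eq_Nil: "plist l \<Longrightarrow> pdec (\<lambda>e. l e = [])"
  using pdec_eq_Leaf[of "\<lambda>e. enc_list (l e)"] enc_list_inject[of _ "[]"]
  by (simp add: plist_def)

lemma plist_filter:
  assumes P: "pdec (\<lambda>z. P (left z) (right z))" and l: "plist l"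
  shows "plist (\<lambda>e. filter (P e) (l e))"
proof -
  have "pdec (\<lambda>z. P (left z) (left (right z)))"
    using ptime_comp[OF P[unfolded pdec_def] ptime_Node[OF ptime_left[OF ptime_id]
        ptime_left[OF ptime_right[OF ptime_id]]]]
    by (simp add: pdec_def)
  then have "ptime (\<lambda>e. foldr (\<lambda>x b. if P e x then Node x b else b) (l e) Leaf)"
    using l by (intro ptime_foldr_additive[where Q = "[:1, 1:]"])
      (auto intro!: ptime_ite ptime_Node ptime_left ptime_right ptime_id ptime_const)
  moreover have "foldr (\<lambda>x b. if P e x then Node x b else b) xs Leaf = enc_list (filter (P e) xs)" for e xs
    by (induction xs) auto
  ultimately show ?thesis by (simp add: plist_def)
qed

lemma pdec_Bex:
  assumes "pdec (\<lambda>z. P (left z) (right z))" and "plist l"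
  shows "pdec (\<lambda>e. \<exists>x\<in>set (l e). P e x)"
  using pdec_not[OF pdec_eq_Nil[OF plist_filter[OF assms]]] by (simp add: filter_empty_conv)

lemma plist_append:
  assumes "plist l" "plist m"
  shows "plist (\<lambda>e. l e @ m e)"
proof -
  have "ptime (\<lambda>e. foldr (\<lambda>x b. Node x b) (l e) (enc_list (m e)))"
    using assms by (intro ptime_foldr_additive[where Q = "[:1, 1:]"])
      (auto intro!: ptime_Node ptime_left ptime_right ptime_id simp: plist_def)
  moreover have "foldr (\<lambda>x b. Node x b) xs (enc_list ys) = enc_list (xs @ ys)" for xs ys
    by (induction xs) auto
  ultimately show ?thesis by (simp add: plist_def)
qed

text \<open>Each \<open>g e x\<close> is packed into one tree and the results are appended in a
  right fold. Sizes of encoded lists add exactly under append, so the growth is additive.\<close>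

lemma plist_concat_map:
  assumes g: "plist (\<lambda>z. g (left z) (right z))" and l: "plist l"
  shows "plist (\<lambda>e. concat (map (g e) (l e)))"
proof -
  have m: "plist (\<lambda>e. map (\<lambda>x. enc_list (g e x)) (l e))"
    using g l by (intro plist_map) (simp_all add: plist_def)
  have "plist (\<lambda>z. list_of (left (right z)) @ list_of (right (right z)))"
    by (intro plist_append plist_list_of ptime_left ptime_right ptime_id)
  then have "ptime (\<lambda>e. foldr (\<lambda>x b. enc_list (list_of x @ list_of b))
      (map (\<lambda>x. enc_list (g e x)) (l e)) Leaf)"
  proof (intro ptime_foldr_additive[OF _ m, where Q = "[:0, 1:]"])
    have "size (enc_list (list_of x @ list_of b)) = size x + size b" for x b
      using size_enc_list[of "list_of x @ list_of b"] size_enc_list[of "list_of x"]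
        size_enc_list[of "list_of b"] by simp
    then show "size (enc_list (list_of x @ list_of b)) \<le> size b + poly [:0, 1:] (size e + size x)" for e x b :: tree
      by simp
  qed (simp_all add: plist_def ptime_const)
  moreover have "foldr (\<lambda>x b. enc_list (list_of x @ list_of b)) (map (\<lambda>x. enc_list (g e x)) xs) Leaf
      = enc_list (concat (map (g e) xs))" for e xs
    by (induction xs) auto
  ultimately show ?thesis by (simp add: plist_def)
qed

lemma pnat_length:
  assumes "plist l"
  shows "pnat (\<lambda>e. length (l e))"
proof -
  have "plist (\<lambda>e. map (\<lambda>_. Leaf) (l e))" using assms by (intro plist_map ptime_const)
  then show ?thesis by (simp add: plist_def pnat_def enc_nat_def map_replicate_const)
qed

lemma pnat_nat_of: "ptime f \<Longrightarrow> pnat (\<lambda>e. nat_of (f e))"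
  unfolding nat_of_def by (intro pnat_length plist_list_of)

text \<open>The factor \<open>c\<close> is fixed in advance, so the program simply contains
  \<open>c\<close> append operations.\<close>

lemma pnat_mult_const:
  assumes "pnat n"
  shows "pnat (\<lambda>e. c * n e)"
proof (induction c)
  case 0
  then show ?case by (simp add: pnat_def ptime_const)
next
  case (Suc c)
  then have "plist (\<lambda>e. replicate (n e) Leaf @ replicate (c * n e) Leaf)"
    using assms by (intro plist_append) (simp_all add: pnat_def plist_def enc_nat_def)
  then show ?case by (simp add: pnat_def plist_def enc_nat_def replicate_add)
qed

text \<open>The unary number serves as a loop counter: folding over it applies \<open>right\<close>,
  that is the tail, \<open>n e\<close> times.\<close>

lemma plist_drop:
  assumes "pnat n" "plist l"
  shows "plist (\<lambda>e. drop (n e) (l e))"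
proof -
  have r: "size (right b) \<le> size b" for b by (cases b) auto
  have "ptime (\<lambda>e. foldr (\<lambda>x b. right b) (replicate (n e) Leaf) (enc_list (l e)))"
    using assms r by (intro ptime_foldr_additive[where Q = 0] ptime_right ptime_id)
      (simp_all add: plist_def pnat_def enc_nat_def)
  moreover have "foldr (\<lambda>x b. right b) (replicate n Leaf) (enc_list xs) = enc_list (drop n xs)" for n xs
  proof (induction n)
    case (Suc n)
    have "right (enc_list ys) = enc_list (tl ys)" for ys by (cases ys) auto
    with Suc show ?case by (simp add: drop_Suc drop_tl)
  qed simp
  ultimately show ?thesis by (simp add: plist_def)
qed

lemma pdec_le:
  assumes "pnat m" "pnat n"
  shows "pdec (\<lambda>e. m e \<le> n e)"
proof -
  have "pdec (\<lambda>e. drop (n e) (replicate (m e) Leaf) = [])"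
    using assms by (intro pdec_eq_Nil plist_drop) (simp_all add: plist_def pnat_def enc_nat_def)
  then show ?thesis by simp
qed

lemma pdec_less: "pnat m \<Longrightarrow> pnat n \<Longrightarrow> pdec (\<lambda>e. m e < n e)"
  using pdec_not[OF pdec_le[of n m]] by (simp add: not_le)

lemma pdec_eq: "pnat m \<Longrightarrow> pnat n \<Longrightarrow> pdec (\<lambda>e. m e = n e)"
  using pdec_conj[OF pdec_le[of m n] pdec_le[of n m]] by (simp add: eq_iff)

text \<open>Each step prepends the length of the list built so far. Its growth depends on the
  accumulator, so \<open>ptime_foldr\<close> is used with a direct quadratic bound.\<close>

lemma plist_enc_nats:
  assumes "pnat n"
  shows "plist (\<lambda>e. map enc_nat (rev [0..<n e]))"
proof -
  let ?S = "\<lambda>x b. Node (enc_nat (length (list_of b))) b"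
  have nums: "foldr ?S xs Leaf = enc_list (map enc_nat (rev [0..<length xs]))" for xs :: "tree list"
    by (induction xs) simp_all
  have sz: "size (enc_list (map enc_nat (rev [0..<n]))) \<le> n * n + n" for n
  proof -
    have "size (enc_nat i) = i" for i by (simp add: enc_nat_def size_enc_list sum_list_replicate)
    then have "size (enc_list (map enc_nat (rev [0..<n]))) = sum_list [0..<n] + n"
      by (simp add: size_enc_list comp_def rev_map[symmetric])
    moreover have "sum_list [0..<n] \<le> n * n" by (induction n) auto
    ultimately show ?thesis by simp
  qed
  have bound: "size (foldr ?S xs Leaf) \<le> poly ([:0, 1:] * [:0, 1:] + [:0, 1:]) (size e + size (enc_list xs))"
    for xs and e :: tree
  proof -
    let ?m = "size e + size (enc_list xs)"
    have "length xs * length xs + length xs \<le> ?m * ?m + ?m"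
      by (intro add_mono mult_mono) (auto simp: size_enc_list)
    with sz[of "length xs"] show ?thesis
      unfolding nums poly_add poly_mult by simp
  qed
  have "ptime (\<lambda>e. foldr ?S (replicate (n e) Leaf) Leaf)"
  proof (rule ptime_foldr[OF _ _ _ bound])
    have "pnat (\<lambda>z. length (list_of (right (right z))))"
      by (intro pnat_length plist_list_of ptime_right ptime_id)
    then show "ptime (\<lambda>z. ?S (left (right z)) (right (right z)))"
      unfolding pnat_def by (intro ptime_Node ptime_right ptime_id)
  qed (use assms in \<open>simp_all add: pnat_def plist_def enc_nat_def ptime_const\<close>)
  then show ?thesis unfolding nums plist_def by simp
qed

lemma polytime_computableI:
  assumes "ptime f" and "\<And>x. x \<in> A \<Longrightarrow> f (enc x) = enc' (F x)"
  shows "polytime_computable A enc enc' F"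
proof -
  obtain p N and P :: "nat poly" where p[rule_format]:
    "\<forall>s. \<exists>t s'. runs p s t s' \<and> t \<le> poly P (size (s 0)) \<and> s' 0 = f (s 0) \<and> (\<forall>x>N. s' x = s x)"
    by (rule ptimeE[OF assms(1)])
  show ?thesis
    unfolding polytime_computable_def
  proof (intro exI[of _ p] exI[of _ P] ballI)
    fix x assume "x \<in> A"
    then show "\<exists>t s. runs p ((\<lambda>_. Leaf)(0 := enc x)) t s \<and> t \<le> poly P (size (enc x)) \<and> s 0 = enc' (F x)"
      using p[of "(\<lambda>_. Leaf)(0 := enc x)"] assms(2) by auto
  qed
qed

section \<open>The kernel as a tree function\<close>

text \<open>In an encoded instance \<open>left e\<close> is the adjacency matrix, and its number of
  rows is the number of vertices.\<close>

definition t_vertices :: "tree \<Rightarrow> tree list" where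
  "t_vertices e = map enc_nat (rev [0..<length (list_of (left e))])"

text \<open>\<open>left\<close> takes the head of the remaining list; past the end this list is
  empty and the result is \<open>Leaf\<close>.\<close>

definition t_nth :: "tree \<Rightarrow> tree \<Rightarrow> tree" where
  "t_nth xs i = left (enc_list (drop (nat_of i) (list_of xs)))"

definition t_candidates :: "tree \<Rightarrow> tree list" where
  "t_candidates e = concat (map (\<lambda>i. map (Node i)
     (filter (\<lambda>j. nat_of i < nat_of j \<and> t_nth (t_nth (left e) i) j \<noteq> Leaf) (t_vertices e))) (t_vertices e))"

definition t_degree :: "tree \<Rightarrow> tree \<Rightarrow> nat" where
  "t_degree v K = length (filter (\<lambda>x. nat_of (left x) = nat_of v \<or> nat_of (right x) = nat_of v) (list_of K))"

definition t_step :: "nat \<Rightarrow> tree \<Rightarrow> tree \<Rightarrow> tree \<Rightarrow> tree" where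
  "t_step c e x K = (if c * (10 * c - 9) * nat_of (right e) \<le> nat_of K \<or>
     (2 * c - 1) * nat_of (right e) \<le> t_degree (left x) K \<or>
     (2 * c - 1) * nat_of (right e) \<le> t_degree (right x) K then K else Node x K)"

definition t_greedy :: "nat \<Rightarrow> tree \<Rightarrow> tree" where
  "t_greedy c e = foldr (t_step c e) (t_candidates e) Leaf"

definition t_active :: "nat \<Rightarrow> tree \<Rightarrow> tree list" where
  "t_active c e = filter (\<lambda>v. \<not> t_degree v (t_greedy c e) \<le> 0) (t_vertices e)"

text \<open>The kept list stores one orientation of each edge, whereas the adjacency matrix is
  symmetric; hence both orientations are tested.\<close>

definition t_adjacent :: "tree \<Rightarrow> tree \<Rightarrow> tree \<Rightarrow> bool" where
  "t_adjacent K i j \<longleftrightarrow> (\<exists>x\<in>set (list_of K).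
     nat_of (left x) = nat_of i \<and> nat_of (right x) = nat_of j \<or>
     nat_of (left x) = nat_of j \<and> nat_of (right x) = nat_of i)"

text \<open>The kept list is computed anew for each matrix entry, which costs only a polynomial
  factor. The parameter \<open>right e\<close> is passed on unchanged.\<close>

definition t_kernel :: "nat \<Rightarrow> tree \<Rightarrow> tree" where
  "t_kernel c e = Node
     (enc_list (map (\<lambda>i. enc_list (map (\<lambda>j. enc_bool (t_adjacent (t_greedy c e) i j)) (t_active c e))) (t_active c e)))
     (right e)"

section \<open>Polynomial running time of the tree functions\<close>

lemma ptime_enc_list: "plist l \<Longrightarrow> ptime (\<lambda>e. enc_list (l e))"
  by (simp add: plist_def)

lemma pnat_0: "pnat (\<lambda>e. 0)"
  by (simp add: pnat_def ptime_const)

lemmas ptime_intros = ptime_id ptime_left ptime_right ptime_Node ptime_enc_bool ptime_enc_list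
  plist_list_of plist_map plist_filter plist_concat_map plist_drop
  pnat_nat_of pnat_length pnat_mult_const pnat_0
  pdec_conj pdec_disj pdec_not pdec_eq_Leaf pdec_eq pdec_le pdec_less pdec_Bex

text \<open>Inside a map or filter the environment is the left part of a pair with the current
  element, so a given \<open>f\<close> occurs there as \<open>f (left z)\<close>, and under two
  nested list operations with two projections.\<close>

lemma ptime_comp_left: "ptime f \<Longrightarrow> ptime (\<lambda>e. f (left e))"
  by (rule ptime_comp[OF _ ptime_left[OF ptime_id]])

lemma plist_t_vertices: "ptime f \<Longrightarrow> plist (\<lambda>e. t_vertices (f e))"
  unfolding t_vertices_def by (intro plist_enc_nats ptime_intros)

lemma ptime_t_nth: "ptime f \<Longrightarrow> ptime g \<Longrightarrow> ptime (\<lambda>e. t_nth (f e) (g e))"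
  unfolding t_nth_def by (intro ptime_intros)

lemma plist_t_candidates: "ptime f \<Longrightarrow> plist (\<lambda>e. t_candidates (f e))"
  unfolding t_candidates_def
  by (intro ptime_intros plist_t_vertices ptime_t_nth ptime_comp_left[of f] ptime_comp_left[of "\<lambda>e. f (left e)"])

lemma pnat_t_degree: "ptime f \<Longrightarrow> ptime g \<Longrightarrow> pnat (\<lambda>e. t_degree (f e) (g e))"
  unfolding t_degree_def by (intro ptime_intros ptime_comp_left[of f])

lemma ptime_t_greedy:
  assumes "ptime f"
  shows "ptime (\<lambda>e. t_greedy c (f e))"
proof -
  have "ptime (\<lambda>z. t_step c (left z) (left (right z)) (right (right z)))"
    unfolding t_step_def by (intro ptime_ite ptime_intros pnat_t_degree)
  then have "ptime (\<lambda>e. t_greedy c e)"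
    unfolding t_greedy_def
    \<comment> \<open>A step either leaves the kept list alone or conses one pair onto it.\<close>
    by (rule ptime_foldr_additive[where Q = "[:1, 1:]"])
      (auto intro: plist_t_candidates ptime_id ptime_const simp: t_step_def)
  from this assms show ?thesis by (rule ptime_comp)
qed

lemma plist_t_active: "ptime f \<Longrightarrow> plist (\<lambda>e. t_active c (f e))"
  unfolding t_active_def by (intro ptime_intros plist_t_vertices pnat_t_degree ptime_t_greedy ptime_comp_left[of f])

lemma pdec_t_adjacent:
  "ptime f \<Longrightarrow> ptime g \<Longrightarrow> ptime h \<Longrightarrow> pdec (\<lambda>e. t_adjacent (f e) (g e) (h e))"
  unfolding t_adjacent_def by (intro ptime_intros ptime_comp_left[of g] ptime_comp_left[of h])

lemma ptime_t_kernel: "ptime (t_kernel c)"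
  unfolding t_kernel_def by (intro ptime_intros plist_t_active pdec_t_adjacent ptime_t_greedy)

section \<open>The tree functions agree with the kernel on encoded instances\<close>

definition enc_pair :: "nat \<times> nat \<Rightarrow> tree" where
  "enc_pair p = Node (enc_nat (fst p)) (enc_nat (snd p))"

lemma t_nth_enc_list: "i < length xs \<Longrightarrow> t_nth (enc_list xs) (enc_nat i) = xs ! i"
  by (simp add: t_nth_def Cons_nth_drop_Suc[symmetric])

lemma t_degree_enc: "t_degree (enc_nat v) (enc_list (map enc_pair ps)) = degree_in v ps"
  by (simp add: t_degree_def degree_in_def filter_map comp_def enc_pair_def case_prod_unfold)

lemma t_adjacent_enc: "t_adjacent (enc_list (map enc_pair ps)) (enc_nat i) (enc_nat j) \<longleftrightarrow> {i, j} \<in> edges_of ps"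
  by (force simp: t_adjacent_def edges_of_def enc_pair_def doubleton_eq_iff)

lemma t_vertices_enc: "t_vertices (enc_instance (n, E, k)) = map enc_nat (rev [0..<n])"
  by (simp add: t_vertices_def enc_instance_def)

lemma t_candidates_enc:
  "t_candidates (enc_instance (n, E, k)) = map enc_pair (candidates n E)"
proof -
  have adj: "t_nth (t_nth (left (enc_instance (n, E, k))) (enc_nat i)) (enc_nat j) \<noteq> Leaf \<longleftrightarrow> {i, j} \<in> E"
    if "i < n" "j < n" for i j
    using that by (simp add: enc_instance_def t_nth_enc_list enc_bool_def)
  show ?thesis
    unfolding t_candidates_def candidates_def t_vertices_enc map_concat map_map comp_def filter_map
    by (intro arg_cong[of _ _ concat] map_cong refl filter_cong arg_cong2[of _ _ _ _ map])
      (auto simp: enc_pair_def adj)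
qed

text \<open>On encoded arguments \<open>t_step\<close> is the body of the recursion of
  \<open>greedy\<close>, so the right fold over the encoded candidates follows \<open>greedy\<close>
  step by step.\<close>

lemma t_greedy_enc:
  "t_greedy c (enc_instance (n, E, k)) = enc_list (map enc_pair (kernel_list c (n, E, k)))"
proof -
  have k: "nat_of (right (enc_instance (n, E, k))) = k"
    by (simp add: enc_instance_def nat_of_def)
  have step: "t_step c (enc_instance (n, E, k)) (enc_pair p) (enc_list (map enc_pair K)) =
    enc_list (map enc_pair (if c * (10 * c - 9) * k \<le> length K \<or> (2 * c - 1) * k \<le> degree_in (fst p) K \<or>
      (2 * c - 1) * k \<le> degree_in (snd p) K then K else p # K))" for p K
    unfolding t_step_def k by (simp add: nat_of_def t_degree_enc enc_pair_def[of p])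
  have "foldr (t_step c (enc_instance (n, E, k))) (map enc_pair ps) Leaf =
    enc_list (map enc_pair (greedy ((2 * c - 1) * k) (c * (10 * c - 9) * k) ps))" for ps
    by (induction ps) (simp_all only: list.map foldr.simps comp_def step greedy.simps Let_def id_apply enc_list.simps)
  then show ?thesis by (simp add: t_greedy_def t_candidates_enc kernel_list_def)
qed

lemma t_active_enc:
  "t_active c (enc_instance (n, E, k)) = map enc_nat (active n (kernel_list c (n, E, k)))"
  by (simp add: t_active_def active_def t_greedy_enc t_vertices_enc filter_map comp_def t_degree_enc)

lemma t_kernel_enc: "t_kernel c (enc_instance I) = enc_instance (load_kernel c I)"
proof -
  obtain n E k where I: "I = (n, E, k)" by (cases I)
  let ?K = "kernel_list c (n, E, k)"
  let ?W = "active n ?K"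
  have adj: "{i, j} \<in> relabel ?W (edges_of ?K) \<longleftrightarrow> {?W ! i, ?W ! j} \<in> edges_of ?K"
    if "i < length ?W" "j < length ?W" for i j
    using that by (auto simp: relabel_def doubleton_eq_iff insert_commute)
  \<comment> \<open>The tree program runs over the entries of the active list, the encoding of the
    relabelled graph over positions; this identity converts one into the other.\<close>
  have m: "map f xs = map (\<lambda>i. f (xs ! i)) [0..<length xs]" for f :: "nat \<Rightarrow> tree" and xs
    by (rule nth_equalityI) simp_all
  have "map (\<lambda>i. enc_list (map (\<lambda>j. enc_bool ({i, j} \<in> edges_of ?K)) ?W)) ?W =
    map (\<lambda>i. enc_list (map (\<lambda>j. enc_bool ({i, j} \<in> relabel ?W (edges_of ?K))) [0..<length ?W])) [0..<length ?W]"
    by (subst (1 2) m) (simp add: adj)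
  moreover have "enc_instance (load_kernel c (n, E, k)) = Node
    (enc_list (map (\<lambda>i. enc_list (map (\<lambda>j. enc_bool ({i, j} \<in> relabel ?W (edges_of ?K))) [0..<length ?W])) [0..<length ?W]))
    (enc_list (replicate k Leaf))"
    by (simp add: load_kernel_def Let_def enc_instance_def)
  moreover have "right (enc_instance (n, E, k)) = enc_list (replicate k Leaf)"
    by (simp add: enc_instance_def)
  ultimately show ?thesis
    unfolding I t_kernel_def t_greedy_enc t_active_enc by (simp add: t_adjacent_enc comp_def)
qed

lemma polytime_load_kernel: "polytime_computable A enc_instance enc_instance (load_kernel c)"
  by (rule polytime_computableI[OF ptime_t_kernel[of c]]) (rule t_kernel_enc)

theorem theorem2:
  fixes c :: nat
  assumes "c \<ge> 1"
  shows "admits_kernel_edges c (\<lambda>k. edge_bound (2 * int c) (int k) (2 * int c * int k)) \<and>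
    (\<forall>k :: nat. edge_bound (2 * int c) (int k) (2 * int c * int k)
        = 16 * (int c)^2 * int k - 6 * int c * int k)"
proof
  show eq: "\<forall>k :: nat. edge_bound (2 * int c) (int k) (2 * int c * int k)
        = 16 * (int c)^2 * int k - 6 * int c * int k"
    by (simp add: edge_bound_def power2_eq_square algebra_simps)
  let ?M = "\<lambda>k. c * (10 * c - 9) * k"
  \<comment> \<open>The gap between the two sides is \<open>(6c^2 + 3c)k\<close>, which is positive
    because \<open>c\<close> and \<open>k\<close> are.\<close>
  have M: "int (?M k) < edge_bound (2 * int c) (int k) (2 * int c * int k)" if "1 \<le> k" for k
  proof -
    have "int (?M k) = (10 * int c * int c - 9 * int c) * int k"
      using assms by (simp add: of_nat_diff algebra_simps)
    also have "\<dots> < (16 * int c * int c - 6 * int c) * int k"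
    proof (rule mult_strict_right_mono)
      have "0 < 3 * int c + 6 * (int c * int c)"
        using assms by (intro add_pos_nonneg) auto
      then show "10 * int c * int c - 9 * int c < 16 * int c * int c - 6 * int c" by simp
    qed (use that in simp)
    finally show ?thesis unfolding eq[rule_format] by (simp add: power2_eq_square algebra_simps)
  qed
  show "admits_kernel_edges c (\<lambda>k. edge_bound (2 * int c) (int k) (2 * int c * int k))"
    unfolding admits_kernel_edges_def
  \<comment> \<open>In the size function, \<open>2 * ?M k\<close> accounts for the vertices, one
    more \<open>?M k\<close> for the edges, and \<open>k\<close> for the unchanged
    parameter.\<close>
  proof (intro exI[of _ "load_kernel c"] exI[of _ "\<lambda>k. 3 * ?M k + k"] conjI polytime_load_kernel, clarify)
    fix n E k n' E' k'
    assume I: "(n, E, k) \<in> lc_instances" and K: "load_kernel c (n, E, k) = (n', E', k')"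
    have k: "1 \<le> k" using I by (simp add: lc_instances_def)
    note props = load_kernel_correct[OF assms I K]
    have "int (card E') \<le> int (?M k)" using props(4) by (simp only: of_nat_le_iff)
    then have "int (card E') < edge_bound (2 * int c) (int k) (2 * int c * int k)"
      using M[OF k] by linarith
    with props show "(n', E', k') \<in> lc_instances \<and>
       ((n, E, k) \<in> LCP c) = ((n', E', k') \<in> LCP c) \<and>
       k' \<le> 3 * ?M k + k \<and> n' + card E' \<le> 3 * ?M k + k \<and>
       int (card E') < edge_bound (2 * int c) (int k) (2 * int c * int k)"
      by simp
  qed
qed

end
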